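(* Let $S\in\mathcal G$ be a geometric action with local action $\ell$, and let $x\in\tilde D$ be such that $\ell(x,y)>0$ for all $y\in\mathbb R^n\setminus\{0\}$. Then $x$ has strong local minimizers.
   Context: $D\subseteq\mathbb R^n$ is open and connected; $\tilde D\subseteq D$ is connected and closed in $D$. $\bar B_r(x)$ is the closed Euclidean ball. Curves. An unparameterized oriented curve in $D$ is an equivalence class of functions $\varphi\in C([0,T],D)$, $T>0$, that are identical up to continuous non-decreasing changes of parameterization (their Fréchet distance vanishes); the representatives are its parameterizations. $\gamma\subset G$ means that the image of $\gamma$ lies in $G$. $\Gamma$ is the set of rectifiable curves. $\tilde C(0,1)$ is the set of $\varphi\in C([0,1],D)$ that are absolutely continuous in neighborhoods of all but at most finitely many $\alpha_i\in[0,1]$, and $\tilde\Gamma\supset\Gamma$ is the set of curves that can be parameterized by some $\varphi\in\tilde C(0,1)$. For $x_1,x_2\in\tilde D$, $\Gamma_{x_1}^{x_2}$ is the set of $\gamma\in\Gamma$ with $\gamma\subset\tilde D$ that start at $x_1$ and end at $x_2$. Standing assumption on $\tilde D$: $\forall x\in\tilde D\ \forall\nu>0\ \exists r>0\ \forall w\in\bar B_r(x)\cap\tilde D\ \exists\gamma\in\Gamma_x^w$ with $\operatorname{length}(\gamma)\le\nu$. Geometric actions. $\mathcal G$ is the set of functionals $S\colon\tilde\Gamma\to[0,\infty]$, $S(\gamma)=\int_0^1\ell(\varphi,\varphi')\,d\alpha$ with $\varphi\in\tilde C(0,1)$ an arbitrary parameterization of $\gamma$, where the local action $\ell\in C(D\times\mathbb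 R^n,[0,\infty))$ satisfies $\ell(x,cy)=c\,\ell(x,y)$ for all $x,y$ and $c\ge0$, and $\ell(x,\cdot)$ is convex for every $x\in D$. $P(x_1,x_2)$ denotes the problem $\inf_{\gamma\in\Gamma_{x_1}^{x_2}}S(\gamma)$; a strong minimizer is $\gamma^\star\in\Gamma_{x_1}^{x_2}$ attaining this infimum. A point $x\in\tilde D$ has strong local minimizers if there exist $r,\eta>0$ and a compact $K\subset\tilde D$ such that for all $x_1,x_2\in\bar B_r(x)\cap\tilde D$ the problem $P(x_1,x_2)$ has a strong minimizer $\gamma^\star\in\Gamma_{x_1}^{x_2}$ with $\gamma^\star\subset K$ and $\operatorname{length}(\gamma^\star)\le\eta$. *)

theory Defs
  imports "HOL-Analysis.Analysis"
begin

text \<open>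
  A pair \<open>(T, \<phi>)\<close> stands for the restriction of \<open>\<phi>\<close> to \<open>{0..T}\<close>; values of \<open>\<phi>\<close> outside
  this interval are never looked at. In particular two pairs that agree on \<open>{0..T}\<close> have
  Frechet distance 0, so they represent the same curve.
\<close>

type_synonym 'n param = "real \<times> (real \<Rightarrow> real ^ 'n)"

type_synonym 'n curve = "'n param set"

definition params :: "(real ^ 'n) set \<Rightarrow> ('n::finite) param set" where
  "params G = {(T, \<phi>). 0 < T \<and> continuous_on {0..T} \<phi> \<and> \<phi> ` {0..T} \<subseteq> G}"

definition time_changes :: "real \<Rightarrow> (real \<Rightarrow> real) set" where
  "time_changes T = {\<alpha>. continuous_on {0..1} \<alpha> \<and> mono_on {0..1} \<alpha> \<and> \<alpha> ` {0..1} = {0..T}}"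

definition frechet_dist :: "('n::finite) param \<Rightarrow> 'n param \<Rightarrow> real" where
  "frechet_dist p q =
     (INF (\<alpha>, \<beta>) \<in> time_changes (fst p) \<times> time_changes (fst q).
        SUP s\<in>{0..1}. dist (snd p (\<alpha> s)) (snd q (\<beta> s)))"

definition frechet_rel :: "(real ^ 'n) set \<Rightarrow> (('n::finite) param \<times> 'n param) set" where
  "frechet_rel G = {(p, q). p \<in> params G \<and> q \<in> params G \<and> frechet_dist p q = 0}"

definition curves :: "(real ^ 'n) set \<Rightarrow> ('n::finite) curve set" where
  "curves G = params G // frechet_rel G"

text \<open>
  The following functions collect their values over all representatives. Lemmas below show
  that they do not depend on the representative.
\<close>

definition param_length :: "('n::finite) param \<Rightarrow> ennreal" where
  "param_length = (\<lambda>(T, \<phi>).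
     SUP (m, t) \<in> {(m :: nat, t :: nat \<Rightarrow> real).
                     (\<forall>i\<le>m. t i \<in> {0..T}) \<and> (\<forall>i<m. t i \<le> t (Suc i))}.
       ennreal (\<Sum>i<m. dist (\<phi> (t i)) (\<phi> (t (Suc i)))))"

definition curve_length :: "('n::finite) curve \<Rightarrow> ennreal" where
  "curve_length \<gamma> = (SUP p\<in>\<gamma>. param_length p)"

definition curve_image :: "('n::finite) curve \<Rightarrow> (real ^ 'n) set" where
  "curve_image \<gamma> = (\<Union>(T, \<phi>)\<in>\<gamma>. \<phi> ` {0..T})"

definition starts_at :: "('n::finite) curve \<Rightarrow> real ^ 'n \<Rightarrow> bool" where
  "starts_at \<gamma> x \<longleftrightarrow> (\<exists>(T, \<phi>)\<in>\<gamma>. \<phi> 0 = x)"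

definition ends_at :: "('n::finite) curve \<Rightarrow> real ^ 'n \<Rightarrow> bool" where
  "ends_at \<gamma> x \<longleftrightarrow> (\<exists>(T, \<phi>)\<in>\<gamma>. \<phi> T = x)"

definition rectifiable_curves :: "(real ^ 'n) set \<Rightarrow> ('n::finite) curve set" where
  "rectifiable_curves D = {\<gamma> \<in> curves D. curve_length \<gamma> < \<infinity>}"

definition connecting_curves ::
  "(real ^ 'n) set \<Rightarrow> (real ^ 'n) set \<Rightarrow> real ^ 'n \<Rightarrow> real ^ 'n \<Rightarrow> ('n::finite) curve set" where
  "connecting_curves D Dt x\<^sub>1 x\<^sub>2 =
     {\<gamma> \<in> rectifiable_curves D. curve_image \<gamma> \<subseteq> Dt \<and> starts_at \<gamma> x\<^sub>1 \<and> ends_at \<gamma> x\<^sub>2}"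

definition abs_continuous_on :: "real set \<Rightarrow> (real \<Rightarrow> 'a::real_normed_vector) \<Rightarrow> bool" where
  "abs_continuous_on I \<phi> \<longleftrightarrow>
     (\<forall>\<epsilon>>0. \<exists>\<delta>>0. \<forall>F :: (real \<times> real) set.
        finite F \<and> (\<forall>(s, t)\<in>F. s \<le> t \<and> {s..t} \<subseteq> I) \<and>
        disjoint_family_on (\<lambda>(s, t). {s<..<t}) F \<and> (\<Sum>(s, t)\<in>F. t - s) < \<delta>
        \<longrightarrow> (\<Sum>(s, t)\<in>F. norm (\<phi> t - \<phi> s)) < \<epsilon>)"

definition C_tilde :: "(real ^ 'n) set \<Rightarrow> (real \<Rightarrow> real ^ ('n::finite)) set" where
  "C_tilde D = {\<phi>. continuous_on {0..1} \<phi> \<and> \<phi> ` {0..1} \<subseteq> D \<and>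
     (\<exists>A. finite A \<and> A \<subseteq> {0..1} \<and>
        (\<forall>\<alpha> \<in> {0..1} - A. \<exists>\<epsilon>>0. abs_continuous_on ({\<alpha> - \<epsilon>..\<alpha> + \<epsilon>} \<inter> {0..1}) \<phi>))}"

definition Gamma_tilde :: "(real ^ 'n) set \<Rightarrow> ('n::finite) curve set" where
  "Gamma_tilde D = {\<gamma> \<in> curves D. \<exists>\<phi> \<in> C_tilde D. (1, \<phi>) \<in> \<gamma>}"

definition local_action ::
  "(real ^ 'n) set \<Rightarrow> (real ^ 'n \<Rightarrow> real ^ ('n::finite) \<Rightarrow> real) \<Rightarrow> bool" where
  "local_action D l \<longleftrightarrow>
     continuous_on (D \<times> UNIV) (\<lambda>(x, y). l x y) \<and>
     (\<forall>x\<in>D. \<forall>y. 0 \<le> l x y) \<and>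
     (\<forall>x\<in>D. \<forall>y. \<forall>c\<ge>0. l x (c *\<^sub>R y) = c * l x y) \<and>
     (\<forall>x\<in>D. convex_on UNIV (l x))"

text \<open>
  Elements of \<open>C_tilde D\<close> are differentiable almost everywhere; the arbitrary value of
  \<^const>\<open>vector_derivative\<close> on the remaining null set does not affect the integral. The
  integral is invariant under changes of parameterization, so requiring the formula for every
  parameterization in \<open>C_tilde D\<close> is consistent; it fixes \<open>S\<close> exactly on its domain
  \<open>Gamma_tilde D\<close>.
\<close>

definition geometric_action ::
  "(real ^ 'n) set \<Rightarrow> (real ^ 'n \<Rightarrow> real ^ 'n \<Rightarrow> real) \<Rightarrow> (('n::finite) curve \<Rightarrow> ennreal) \<Rightarrow> bool"
where
  "geometric_action D l S \<longleftrightarrow> local_action D l \<and>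
     (\<forall>\<gamma> \<in> Gamma_tilde D. \<forall>\<phi> \<in> C_tilde D. (1, \<phi>) \<in> \<gamma> \<longrightarrow>
        S \<gamma> = (\<integral>\<^sup>+\<alpha>\<in>{0..1}.
                 ennreal (l (\<phi> \<alpha>) (vector_derivative \<phi> (at \<alpha> within {0..1}))) \<partial>lborel))"

definition strong_minimizer ::
  "(real ^ 'n) set \<Rightarrow> (real ^ 'n) set \<Rightarrow> ('n curve \<Rightarrow> ennreal) \<Rightarrow> real ^ 'n \<Rightarrow> real ^ 'n
     \<Rightarrow> ('n::finite) curve \<Rightarrow> bool" where
  "strong_minimizer D Dt S x\<^sub>1 x\<^sub>2 \<gamma> \<longleftrightarrow>
     \<gamma> \<in> connecting_curves D Dt x\<^sub>1 x\<^sub>2 \<and>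
     S \<gamma> = (INF \<gamma>'\<in>connecting_curves D Dt x\<^sub>1 x\<^sub>2. S \<gamma>')"

definition has_strong_local_minimizers ::
  "(real ^ 'n) set \<Rightarrow> (real ^ 'n) set \<Rightarrow> (('n::finite) curve \<Rightarrow> ennreal) \<Rightarrow> real ^ 'n \<Rightarrow> bool"
where
  "has_strong_local_minimizers D Dt S x \<longleftrightarrow>
     (\<exists>r>0. \<exists>\<eta>>0. \<exists>K. compact K \<and> K \<subseteq> Dt \<and>
        (\<forall>x\<^sub>1 \<in> cball x r \<inter> Dt. \<forall>x\<^sub>2 \<in> cball x r \<inter> Dt.
           \<exists>\<gamma>. strong_minimizer D Dt S x\<^sub>1 x\<^sub>2 \<gamma> \<and>
               curve_image \<gamma> \<subseteq> K \<and> curve_length \<gamma> \<le> ennreal \<eta>))"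

lemma time_changesD:
  assumes "\<alpha> \<in> time_changes T"
  shows "continuous_on {0..1} \<alpha>" "mono_on {0..1} \<alpha>" "\<alpha> ` {0..1} = {0..T}"
    "\<And>s. s \<in> {0..1} \<Longrightarrow> \<alpha> s \<in> {0..T}"
  using assms by (auto simp: time_changes_def)

lemma time_changes_ends:
  assumes "\<alpha> \<in> time_changes T" "0 < T"
  shows "\<alpha> 0 = 0" "\<alpha> 1 = T"
proof -
  note a = time_changesD[OF assms(1)]
  have "0 \<in> \<alpha> ` {0..1}" "T \<in> \<alpha> ` {0..1}"
    using a(3) assms(2) by auto
  then obtain s t where st: "s \<in> {0..1}" "\<alpha> s = 0" "t \<in> {0..1}" "\<alpha> t = T"
    by force
  have "\<alpha> 0 \<le> \<alpha> s" "\<alpha> t \<le> \<alpha> 1"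
    using mono_onD[OF a(2), of 0 s] mono_onD[OF a(2), of t 1] st(1,3) by simp_all
  moreover have "\<alpha> 0 \<in> {0..T}" "\<alpha> 1 \<in> {0..T}" using a(4) by auto
  ultimately show "\<alpha> 0 = 0" "\<alpha> 1 = T" using st by auto
qed

lemma linear_time_change: "0 < T \<Longrightarrow> (\<lambda>s. T * s) \<in> time_changes T"
  by (auto simp: time_changes_def intro!: continuous_intros mono_onI)

lemma time_change_comp:
  assumes "\<alpha> \<in> time_changes T" "\<sigma> \<in> time_changes 1"
  shows "\<alpha> \<circ> \<sigma> \<in> time_changes T"
proof -
  note a = time_changesD[OF assms(1)] and s = time_changesD[OF assms(2)]
  have "continuous_on {0..1} (\<alpha> \<circ> \<sigma>)"
    using continuous_on_compose[OF s(1)] a(1) s(3) by simp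
  moreover have "mono_on {0..1} (\<alpha> \<circ> \<sigma>)"
    using a(2) s(2,4) by (auto simp: mono_on_def)
  moreover have "(\<alpha> \<circ> \<sigma>) ` {0..1} = {0..T}"
    using a(3) s(3) by (simp only: image_comp[symmetric])
  ultimately show ?thesis by (simp add: time_changes_def)
qed

lemma bdd_above_dist_time_changes:
  assumes "(T, \<phi>) \<in> params G" "(U, \<psi>) \<in> params G"
    and "\<alpha> \<in> time_changes T" "\<beta> \<in> time_changes U"
  shows "bdd_above ((\<lambda>s. dist (\<phi> (\<alpha> s)) (\<psi> (\<beta> s))) ` {0..1::real})"
proof -
  note a = time_changesD[OF assms(3)] and b = time_changesD[OF assms(4)]
  have "continuous_on {0..1} (\<lambda>s. \<phi> (\<alpha> s))" "continuous_on {0..1} (\<lambda>s. \<psi> (\<beta> s))"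
    using assms(1,2) a b
    by (auto simp: params_def intro!: continuous_on_compose2[of _ \<phi> _ \<alpha>] continuous_on_compose2[of _ \<psi> _ \<beta>])
  then have "compact ((\<lambda>s. dist (\<phi> (\<alpha> s)) (\<psi> (\<beta> s))) ` {0..1::real})"
    by (intro compact_continuous_image continuous_intros) auto
  then show ?thesis by (simp add: bounded_imp_bdd_above compact_imp_bounded)
qed

lemma frechet_dist_eq_0_iff:
  assumes "(T, \<phi>) \<in> params G" "(U, \<psi>) \<in> params G"
  shows "frechet_dist (T, \<phi>) (U, \<psi>) = 0 \<longleftrightarrow>
    (\<forall>e>0. \<exists>\<alpha>\<in>time_changes T. \<exists>\<beta>\<in>time_changes U. \<forall>s\<in>{0..1}. dist (\<phi> (\<alpha> s)) (\<psi> (\<beta> s)) < e)"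
    (is "_ \<longleftrightarrow> ?R")
proof -
  define F where "F = (\<lambda>(\<alpha>, \<beta>). SUP s\<in>{0..1::real}. dist (\<phi> (\<alpha> s)) (\<psi> (\<beta> s)))"
  define X where "X = time_changes T \<times> time_changes U"
  have fd: "frechet_dist (T, \<phi>) (U, \<psi>) = (INF x\<in>X. F x)"
    by (simp add: frechet_dist_def F_def X_def)
  have T: "0 < T" "0 < U" using assms by (auto simp: params_def)
  have ne: "X \<noteq> {}" using linear_time_change T by (auto simp: X_def)
  have le: "dist (\<phi> (\<alpha> s)) (\<psi> (\<beta> s)) \<le> F (\<alpha>, \<beta>)"
    if "(\<alpha>, \<beta>) \<in> X" "s \<in> {0..1}" for \<alpha> \<beta> s
    unfolding F_def using that bdd_above_dist_time_changes[OF assms]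
    by (auto simp: X_def intro!: cSUP_upper)
  have nn: "0 \<le> F x" if "x \<in> X" for x
  proof (cases x)
    case (Pair \<alpha> \<beta>)
    have "0 \<le> dist (\<phi> (\<alpha> 0)) (\<psi> (\<beta> 0))" by simp
    also have "\<dots> \<le> F (\<alpha>, \<beta>)" using that Pair by (intro le) auto
    finally show ?thesis using Pair by simp
  qed
  have bdd: "bdd_below (F ` X)" using nn by (auto intro!: bdd_belowI)
  show ?thesis
  proof
    assume "frechet_dist (T, \<phi>) (U, \<psi>) = 0"
    then have *: "\<exists>x\<in>X. F x < e" if "e > 0" for e
      using cINF_less_iff[OF ne bdd, of e] fd that by simp
    show ?R
    proof (intro allI impI)
      fix e :: real assume "e > 0"
      then obtain \<alpha> \<beta> where "(\<alpha>, \<beta>) \<in> X" "F (\<alpha>, \<beta>) < e" using * by force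
      then show "\<exists>\<alpha>\<in>time_changes T. \<exists>\<beta>\<in>time_changes U. \<forall>s\<in>{0..1}. dist (\<phi> (\<alpha> s)) (\<psi> (\<beta> s)) < e"
        using le unfolding X_def by (blast intro: le_less_trans)
    qed
  next
    assume R: ?R
    have "(INF x\<in>X. F x) \<le> e" if "e > 0" for e
    proof -
      obtain \<alpha> \<beta> where ab: "(\<alpha>, \<beta>) \<in> X" "\<And>s. s \<in> {0..1} \<Longrightarrow> dist (\<phi> (\<alpha> s)) (\<psi> (\<beta> s)) < e"
        using R \<open>e > 0\<close> unfolding X_def by blast
      have "F (\<alpha>, \<beta>) \<le> e"
        unfolding F_def using ab(2) by (auto intro!: cSUP_least simp: less_imp_le)
      then show ?thesis using cINF_lower[OF bdd ab(1)] by linarith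
    qed
    then have "(INF x\<in>X. F x) \<le> 0" using field_le_epsilon[of "INF x\<in>X. F x" 0] by auto
    moreover have "0 \<le> (INF x\<in>X. F x)" using ne nn by (rule cINF_greatest)
    ultimately show "frechet_dist (T, \<phi>) (U, \<psi>) = 0" using fd by simp
  qed
qed

lemma frechet_rel_close:
  assumes "((T, \<phi>), (U, \<psi>)) \<in> frechet_rel G" "0 < e"
  obtains \<alpha> \<beta> where "\<alpha> \<in> time_changes T" "\<beta> \<in> time_changes U"
    "\<And>s. s \<in> {0..1} \<Longrightarrow> dist (\<phi> (\<alpha> s)) (\<psi> (\<beta> s)) < e"
proof -
  have "(T, \<phi>) \<in> params G" "(U, \<psi>) \<in> params G" "frechet_dist (T, \<phi>) (U, \<psi>) = 0"
    using assms(1) by (auto simp: frechet_rel_def)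
  then have "\<exists>\<alpha>\<in>time_changes T. \<exists>\<beta>\<in>time_changes U.
      \<forall>s\<in>{0..1}. dist (\<phi> (\<alpha> s)) (\<psi> (\<beta> s)) < e"
    using frechet_dist_eq_0_iff assms(2) by blast
  then show ?thesis using that by blast
qed

lemma params_uniformly_continuous:
  assumes "(T, \<phi>) \<in> params G" "0 < e"
  obtains d where "0 < d" "\<And>s t. \<lbrakk>s \<in> {0..T}; t \<in> {0..T}; \<bar>s - t\<bar> < d\<rbrakk> \<Longrightarrow> dist (\<phi> s) (\<phi> t) < e"
proof -
  have "uniformly_continuous_on {0..T} \<phi>"
    using assms(1) by (intro compact_uniformly_continuous) (auto simp: params_def)
  then show ?thesis
    using that assms(2) unfolding uniformly_continuous_on_def dist_real_def
    by metis
qed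

lemma equiv_frechet_rel: "equiv (params G) (frechet_rel G)"
proof (rule equivI)
  show "refl_on (params G) (frechet_rel G)"
  proof (rule refl_onI)
    fix p assume p: "p \<in> params G"
    obtain T \<phi> where [simp]: "p = (T, \<phi>)" by (cases p)
    have "0 < T" using p by (auto simp: params_def)
    have "frechet_dist p p = 0"
      using frechet_dist_eq_0_iff[of T \<phi> G T \<phi>] p linear_time_change[OF \<open>0 < T\<close>] by force
    then show "(p, p) \<in> frechet_rel G" using p by (simp add: frechet_rel_def)
  qed
next
  show "sym (frechet_rel G)"
  proof (rule symI)
    fix p q :: "'a param" assume pq: "(p, q) \<in> frechet_rel G"
    obtain T \<phi> where [simp]: "p = (T, \<phi>)" by (cases p)
    obtain U \<psi> where [simp]: "q = (U, \<psi>)" by (cases q)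
    show "(q, p) \<in> frechet_rel G"
      using pq frechet_dist_eq_0_iff[of T \<phi> G U \<psi>] frechet_dist_eq_0_iff[of U \<psi> G T \<phi>]
      by (auto simp: frechet_rel_def dist_commute) blast
  qed
next
  show "trans (frechet_rel G)"
  proof (rule transI)
    fix p q r :: "'a param"
    assume pq: "(p, q) \<in> frechet_rel G" and qr: "(q, r) \<in> frechet_rel G"
    obtain T \<phi> where p: "p = (T, \<phi>)" by (cases p)
    obtain U \<psi> where q: "q = (U, \<psi>)" by (cases q)
    obtain V \<theta> where r: "r = (V, \<theta>)" by (cases r)
    have P: "(T, \<phi>) \<in> params G" "(U, \<psi>) \<in> params G" "(V, \<theta>) \<in> params G"
      using pq qr p q r by (auto simp: frechet_rel_def)
    have U: "0 < U" using P by (auto simp: params_def)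
    have "\<exists>\<alpha>\<in>time_changes T. \<exists>\<beta>\<in>time_changes V. \<forall>s\<in>{0..1}. dist (\<phi> (\<alpha> s)) (\<theta> (\<beta> s)) < e"
      if "e > 0" for e
    proof -
      have e3: "e / 3 > 0" using that by simp
      obtain \<alpha>1 \<beta>1 where 1: "\<alpha>1 \<in> time_changes T" "\<beta>1 \<in> time_changes U"
        "\<And>s. s \<in> {0..1} \<Longrightarrow> dist (\<phi> (\<alpha>1 s)) (\<psi> (\<beta>1 s)) < e / 3"
        using frechet_rel_close[OF pq[unfolded p q] e3] by blast
      obtain \<alpha>2 \<beta>2 where 2: "\<alpha>2 \<in> time_changes U" "\<beta>2 \<in> time_changes V"
        "\<And>s. s \<in> {0..1} \<Longrightarrow> dist (\<psi> (\<alpha>2 s)) (\<theta> (\<beta>2 s)) < e / 3"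
        using frechet_rel_close[OF qr[unfolded q r] e3] by blast
      obtain d where d: "0 < d"
        "\<And>s t. \<lbrakk>s \<in> {0..U}; t \<in> {0..U}; \<bar>s - t\<bar> < d\<rbrakk> \<Longrightarrow> dist (\<psi> s) (\<psi> t) < e / 3"
        using params_uniformly_continuous[OF P(2) e3] by blast
      note a = time_changesD[OF 2(1)] and a0 = time_changes_ends[OF 2(1) U]
        and b = time_changesD[OF 1(2)]
      define c where "c = min 1 (d / (2 * U))"
      have c: "0 < c" "c \<le> 1" "c * U < d"
      proof -
        show "0 < c" "c \<le> 1" using d U by (auto simp: c_def)
        have "c \<le> d / (2 * U)" by (simp add: c_def)
        then have "c * U \<le> d / 2" using U by (simp add: field_simps)
        then show "c * U < d" using d by simp
      qed
      define h where "h = (\<lambda>s. (1 - c) * \<alpha>2 s + c * (U * s))"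
      have hcont: "continuous_on {0..1} h"
        unfolding h_def by (intro continuous_intros a(1))
      have hmono: "h s < h t" if "s \<in> {0..1}" "t \<in> {0..1}" "s < t" for s t
      proof -
        have "\<alpha>2 s \<le> \<alpha>2 t" using a(2) that by (auto intro: mono_onD)
        then have "(1 - c) * \<alpha>2 s \<le> (1 - c) * \<alpha>2 t" using c by (intro mult_left_mono) auto
        moreover have "c * (U * s) < c * (U * t)" using c U that by simp
        ultimately show ?thesis by (simp add: h_def)
      qed
      have hends: "h 0 = 0" "h 1 = U" using a0 by (auto simp: h_def algebra_simps)
      have himg: "h ` {0..1} = {0..U}"
      proof
        show "h ` {0..1} \<subseteq> {0..U}"
        proof
          fix y assume "y \<in> h ` {0..1}"
          then obtain s where s: "s \<in> {0..1}" "y = h s" by auto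
          have "h 0 \<le> h s" using hmono[of 0 s] s by (cases "s = 0") auto
          moreover have "h s \<le> h 1" using hmono[of s 1] s by (cases "s = 1") auto
          ultimately show "y \<in> {0..U}" using s hends by auto
        qed
        show "{0..U} \<subseteq> h ` {0..1}"
        proof
          fix y assume y: "y \<in> {0..U}"
          then have "\<exists>s. 0 \<le> s \<and> s \<le> 1 \<and> h s = y"
            using IVT'[of h 0 y 1] hcont hends by auto
          then show "y \<in> h ` {0..1}" by force
        qed
      qed
      have hinj: "inj_on h {0..1}"
        by (rule linorder_inj_onI) (use hmono in force)+
      obtain g where g: "homeomorphism {0..1} {0..U} h g"
        using homeomorphism_compact[OF _ hcont himg hinj] by auto
      note gD = homeomorphism_cont2[OF g] homeomorphism_image2[OF g] homeomorphism_apply2[OF g]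
      have gmono: "mono_on {0..U} g"
      proof (rule mono_onI)
        fix s t assume st: "s \<in> {0..U}" "t \<in> {0..U}" "s \<le> t"
        then have gin: "g s \<in> {0..1}" "g t \<in> {0..1}" using gD(2) by blast+
        show "g s \<le> g t"
        proof (rule ccontr)
          assume "\<not> g s \<le> g t"
          then have "h (g t) < h (g s)" using hmono gin by auto
          then show False using gD(3) st by auto
        qed
      qed
      have tc: "g \<circ> \<beta>1 \<in> time_changes 1"
      proof -
        have "continuous_on {0..1} (g \<circ> \<beta>1)"
          using continuous_on_compose[OF b(1)] gD(1) b(3) by simp
        moreover have "mono_on {0..1} (g \<circ> \<beta>1)"
          using gmono b(2,4) by (auto simp: mono_on_def)
        moreover have "(g \<circ> \<beta>1) ` {0..1} = {0..1}"
          using gD(2) b(3) by (simp only: image_comp[symmetric])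
        ultimately show ?thesis by (simp add: time_changes_def)
      qed
      have near: "dist (\<psi> (h s)) (\<theta> (\<beta>2 s)) < 2 * e / 3" if s: "s \<in> {0..1}" for s
      proof -
        have r: "h s \<in> {0..U}" "\<alpha>2 s \<in> {0..U}" using himg a(4) s by auto
        have "U * s \<in> {0..U}" using s U by (auto simp: mult_left_le)
        then have "\<bar>U * s - \<alpha>2 s\<bar> \<le> U" using r by auto
        then have "c * \<bar>U * s - \<alpha>2 s\<bar> \<le> c * U" using c by (intro mult_left_mono) auto
        moreover have "h s - \<alpha>2 s = c * (U * s - \<alpha>2 s)" by (simp add: h_def algebra_simps)
        ultimately have "\<bar>h s - \<alpha>2 s\<bar> < d" using c by (simp only: abs_mult)
        then have "dist (\<psi> (h s)) (\<psi> (\<alpha>2 s)) < e / 3" using d(2) r by blast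
        then show ?thesis
          using 2(3)[OF s] dist_triangle[of "\<psi> (h s)" "\<theta> (\<beta>2 s)" "\<psi> (\<alpha>2 s)"] by simp
      qed
      have "dist (\<phi> (\<alpha>1 s)) (\<theta> ((\<beta>2 \<circ> (g \<circ> \<beta>1)) s)) < e" if s: "s \<in> {0..1}" for s
      proof -
        have "(g \<circ> \<beta>1) s \<in> {0..1}" using time_changesD(4)[OF tc s] .
        from near[OF this] have "dist (\<psi> (\<beta>1 s)) (\<theta> (\<beta>2 (g (\<beta>1 s)))) < 2 * e / 3"
          using gD(3) b(4)[OF s] by simp
        then show ?thesis
          using 1(3)[OF s] dist_triangle[of "\<phi> (\<alpha>1 s)" "\<theta> (\<beta>2 (g (\<beta>1 s)))" "\<psi> (\<beta>1 s)"] by simp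
      qed
      then show ?thesis using 1(1) time_change_comp[OF 2(2) tc] by blast
    qed
    then show "(p, r) \<in> frechet_rel G"
      using P frechet_dist_eq_0_iff[OF P(1,3)] by (simp add: frechet_rel_def p r)
  qed
next
  show "frechet_rel G \<subseteq> params G \<times> params G" by (auto simp: frechet_rel_def)
qed

lemma curve_representatives:
  assumes "\<gamma> \<in> curves G" "p \<in> \<gamma>" "q \<in> \<gamma>"
  shows "(p, q) \<in> frechet_rel G"
  using quotient_eq_iff[OF equiv_frechet_rel] assms unfolding curves_def by metis

lemma frechet_rel_param_length_le:
  assumes "(p, q) \<in> frechet_rel G"
  shows "param_length p \<le> param_length q"
proof -
  obtain T \<phi> where p: "p = (T, \<phi>)" by (cases p)
  obtain U \<psi> where q: "q = (U, \<psi>)" by (cases q)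
  have P: "(T, \<phi>) \<in> params G" "(U, \<psi>) \<in> params G"
    using assms p q by (auto simp: frechet_rel_def)
  have "ennreal (\<Sum>i<m. dist (\<phi> (t i)) (\<phi> (t (Suc i)))) \<le> param_length q"
    if t: "\<forall>i\<le>m. t i \<in> {0..T}" "\<forall>i<m. t i \<le> t (Suc i)" for m :: nat and t :: "nat \<Rightarrow> real"
  proof (rule ennreal_le_epsilon)
    fix e :: real assume "0 < e"
    define e' where "e' = e / (2 * real m + 1)"
    have e': "0 < e'" "2 * real m * e' \<le> e" using \<open>0 < e\<close> by (auto simp: e'_def field_simps)
    obtain \<alpha> \<beta> where ab: "\<alpha> \<in> time_changes T" "\<beta> \<in> time_changes U"
      "\<And>s. s \<in> {0..1} \<Longrightarrow> dist (\<phi> (\<alpha> s)) (\<psi> (\<beta> s)) < e'"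
      using frechet_rel_close[OF assms[unfolded p q] e'(1)] by blast
    note a = time_changesD[OF ab(1)] and b = time_changesD[OF ab(2)]
    define f where "f = inv_into {0..1} \<alpha>"
    have f: "f x \<in> {0..1}" "\<alpha> (f x) = x" if "x \<in> {0..T}" for x
      using that a(3) inv_into_into[of x \<alpha> "{0..1}"] f_inv_into_f[of x \<alpha> "{0..1}"]
      by (auto simp: f_def)
    have fmono: "f x \<le> f y" if "x \<in> {0..T}" "y \<in> {0..T}" "x \<le> y" for x y
    proof (rule ccontr)
      assume "\<not> f x \<le> f y"
      then have "\<alpha> (f y) \<le> \<alpha> (f x)" using a(2) f that by (intro mono_onD[of "{0..1}" \<alpha>]) auto
      then have "x = y" using f that by auto
      then show False using \<open>\<not> f x \<le> f y\<close> by simp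
    qed
    define u where "u = (\<lambda>i. \<beta> (f (t i)))"
    have u1: "\<forall>i\<le>m. u i \<in> {0..U}" using t f b(4) by (auto simp: u_def)
    have u2: "\<forall>i<m. u i \<le> u (Suc i)"
      using t f fmono b(2) by (auto simp: u_def intro!: mono_onD[of "{0..1}" \<beta>])
    have close: "dist (\<phi> (t i)) (\<psi> (u i)) < e'" if "i \<le> m" for i
      using ab(3)[of "f (t i)"] f t that by (auto simp: u_def)
    have "dist (\<phi> (t i)) (\<phi> (t (Suc i))) \<le> dist (\<psi> (u i)) (\<psi> (u (Suc i))) + 2 * e'"
      if "i < m" for i
      using close[of i] close[of "Suc i"] that
        dist_triangle[of "\<phi> (t i)" "\<phi> (t (Suc i))" "\<psi> (u i)"]
        dist_triangle[of "\<psi> (u i)" "\<phi> (t (Suc i))" "\<psi> (u (Suc i))"]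
      by (simp add: dist_commute)
    then have "(\<Sum>i<m. dist (\<phi> (t i)) (\<phi> (t (Suc i))))
        \<le> (\<Sum>i<m. dist (\<psi> (u i)) (\<psi> (u (Suc i))) + 2 * e')"
      by (intro sum_mono) auto
    also have "\<dots> \<le> (\<Sum>i<m. dist (\<psi> (u i)) (\<psi> (u (Suc i)))) + e"
      using e'(2) by (simp add: sum.distrib algebra_simps)
    finally have "ennreal (\<Sum>i<m. dist (\<phi> (t i)) (\<phi> (t (Suc i))))
        \<le> ennreal (\<Sum>i<m. dist (\<psi> (u i)) (\<psi> (u (Suc i)))) + ennreal e"
      using \<open>0 < e\<close> by (subst ennreal_plus[symmetric]) (auto intro!: ennreal_leI sum_nonneg)
    also have "\<dots> \<le> param_length q + ennreal e"
    proof (rule add_right_mono)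
      show "ennreal (\<Sum>i<m. dist (\<psi> (u i)) (\<psi> (u (Suc i)))) \<le> param_length q"
        unfolding q param_length_def
        using u1 u2 by (auto intro!: SUP_upper2[of "(m, u)"])
    qed
    finally show "ennreal (\<Sum>i<m. dist (\<phi> (t i)) (\<phi> (t (Suc i)))) \<le> param_length q + ennreal e" .
  qed
  then show ?thesis
    unfolding p param_length_def by (auto intro!: SUP_least)
qed

lemma curve_length_eq:
  assumes "\<gamma> \<in> curves G" "p \<in> \<gamma>"
  shows "curve_length \<gamma> = param_length p"
  unfolding curve_length_def
proof (rule antisym)
  show "(SUP q\<in>\<gamma>. param_length q) \<le> param_length p"
    using assms curve_representatives frechet_rel_param_length_le by (blast intro: SUP_least)
qed (use assms in \<open>auto intro: SUP_upper\<close>)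

lemma frechet_rel_image_subset:
  assumes "((T, \<phi>), (U, \<psi>)) \<in> frechet_rel G"
  shows "\<phi> ` {0..T} \<subseteq> \<psi> ` {0..U}"
proof
  fix x assume "x \<in> \<phi> ` {0..T}"
  then obtain t where t: "t \<in> {0..T}" "x = \<phi> t" by auto
  have P: "(T, \<phi>) \<in> params G" "(U, \<psi>) \<in> params G"
    using assms by (auto simp: frechet_rel_def)
  have "closed (\<psi> ` {0..U})"
    using P by (intro compact_imp_closed compact_continuous_image) (auto simp: params_def)
  moreover have "\<exists>y\<in>\<psi> ` {0..U}. dist y x < e" if "e > 0" for e :: real
  proof -
    obtain \<alpha> \<beta> where ab: "\<alpha> \<in> time_changes T" "\<beta> \<in> time_changes U"
      "\<And>s. s \<in> {0..1} \<Longrightarrow> dist (\<phi> (\<alpha> s)) (\<psi> (\<beta> s)) < e"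
      using frechet_rel_close[OF assms \<open>e > 0\<close>] by blast
    obtain s where s: "s \<in> {0..1}" "\<alpha> s = t"
      using time_changesD(3)[OF ab(1)] t(1) by (metis imageE)
    show ?thesis
      using ab(3)[OF s(1)] s t time_changesD(4)[OF ab(2) s(1)] by (auto simp: dist_commute)
  qed
  ultimately show "x \<in> \<psi> ` {0..U}"
    using closed_approachable[of "\<psi> ` {0..U}" x] by blast
qed

lemma curve_image_eq:
  assumes "\<gamma> \<in> curves G" "(T, \<phi>) \<in> \<gamma>"
  shows "curve_image \<gamma> = \<phi> ` {0..T}"
proof -
  have "\<psi> ` {0..U} \<subseteq> \<phi> ` {0..T}" if "(U, \<psi>) \<in> \<gamma>" for U \<psi>
    using frechet_rel_image_subset[OF curve_representatives[OF assms(1) that assms(2)]] .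
  then show ?thesis using assms(2) unfolding curve_image_def by fast
qed

lemma frechet_rel_ends:
  assumes "((T, \<phi>), (U, \<psi>)) \<in> frechet_rel G"
  shows "\<phi> 0 = \<psi> 0" "\<phi> T = \<psi> U"
proof -
  have P: "(T, \<phi>) \<in> params G" "(U, \<psi>) \<in> params G"
    using assms by (auto simp: frechet_rel_def)
  then have TU: "0 < T" "0 < U" by (auto simp: params_def)
  have "dist (\<phi> 0) (\<psi> 0) \<le> 0 + e \<and> dist (\<phi> T) (\<psi> U) \<le> 0 + e" if "e > 0" for e :: real
  proof -
    obtain \<alpha> \<beta> where ab: "\<alpha> \<in> time_changes T" "\<beta> \<in> time_changes U"
      "\<And>s. s \<in> {0..1} \<Longrightarrow> dist (\<phi> (\<alpha> s)) (\<psi> (\<beta> s)) < e"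
      using frechet_rel_close[OF assms \<open>e > 0\<close>] by blast
    show ?thesis
      using ab(3)[of 0] ab(3)[of 1] time_changes_ends[OF ab(1) TU(1)]
        time_changes_ends[OF ab(2) TU(2)] by simp
  qed
  then have "dist (\<phi> 0) (\<psi> 0) \<le> 0" "dist (\<phi> T) (\<psi> U) \<le> 0"
    by (blast intro: field_le_epsilon)+
  then show "\<phi> 0 = \<psi> 0" "\<phi> T = \<psi> U" by auto
qed

lemma curve_ends_iff:
  assumes "\<gamma> \<in> curves G" "(T, \<phi>) \<in> \<gamma>"
  shows "starts_at \<gamma> x \<longleftrightarrow> \<phi> 0 = x" "ends_at \<gamma> x \<longleftrightarrow> \<phi> T = x"
proof -
  have *: "\<psi> 0 = \<phi> 0 \<and> \<psi> U = \<phi> T" if "(U, \<psi>) \<in> \<gamma>" for U \<psi>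
    using frechet_rel_ends[OF curve_representatives[OF assms(1) that assms(2)]] by simp
  show "starts_at \<gamma> x \<longleftrightarrow> \<phi> 0 = x"
    unfolding starts_at_def case_prod_unfold using *[of "fst p" "snd p" for p] assms(2)
    by (metis fst_conv prod.collapse snd_conv)
  show "ends_at \<gamma> x \<longleftrightarrow> \<phi> T = x"
    unfolding ends_at_def case_prod_unfold using *[of "fst p" "snd p" for p] assms(2)
    by (metis fst_conv prod.collapse snd_conv)
qed

end

theory Submission
  imports Defs "HOL-Complex_Analysis.Great_Picard"
begin

text \<open>
  The minimizer is found by the direct method. Since \<open>l x\<close> is positive on the unit sphere,
  there are \<open>\<rho>, c, C > 0\<close> with \<open>c * norm y \<le> l z y \<le> C * norm y\<close> for all \<open>z \<in> cball x \<rho>\<close>.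
  By the assumption on \<open>Dt\<close>, two points close enough to \<open>x\<close> can be joined through \<open>x\<close> by a
  curve so short that its action is below \<open>c * \<rho> / 2\<close>. A curve that starts in \<open>cball x (\<rho> / 2)\<close>
  and leaves \<open>cball x \<rho>\<close> has action at least \<open>c * \<rho> / 2\<close>, so the curves of a minimizing sequence
  eventually stay in the compact set \<open>K = cball x \<rho> \<inter> Dt\<close>, where their length is at most their
  action divided by \<open>c\<close>. Parameterized on \<open>{0..1}\<close> they are therefore Lipschitz with a common
  constant, and the Arzela--Ascoli theorem gives a uniformly convergent subsequence. Its limit is
  again a Lipschitz path in \<open>K\<close>, and it is a minimizer because the action is lower semicontinuous.

  All statements about the action go through the sums
  \<open>\<Sum>i<N. l (\<phi> (i / N)) (\<phi> (Suc i / N) - \<phi> (i / N))\<close>. For a Lipschitz path \<open>\<phi>\<close> they converge to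
  the action as \<open>N\<close> tends to infinity (\<open>action_integral_eq_lim\<close>), by dominated convergence: they
  are integrals of step functions that converge wherever \<open>\<phi>\<close> is differentiable, hence almost
  everywhere. As \<open>l z\<close> is convex and homogeneous, it is subadditive, and so refining a partition
  decreases the sum at most by an error that is uniform over all paths in \<open>K\<close> with a given
  Lipschitz constant. Each single sum depends continuously on \<open>\<phi>\<close>, and lower semicontinuity
  follows (\<open>action_limit_lower_semicontinuous\<close>). The bounds on action and length are immediate
  for the sums.

  The two remaining ingredients are the almost everywhere differentiability of Lipschitz functions
  of one real variable (\<open>AE_differentiable_lipschitz\<close>), which is derived from the Vitali covering
  theorem, and the existence of Lipschitz parameterizations of rectifiable curves
  (\<open>lipschitz_reparametrization\<close>).
\<close>

section \<open>Lipschitz functions are differentiable almost everywhere\<close>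

lemma emeasure_add_interval_measure:
  fixes f h :: "real \<Rightarrow> real"
  assumes f: "mono f" "continuous_on UNIV f" and h: "mono h" "continuous_on UNIV h"
    and sum: "\<And>x. f x + h x = x" and E: "E \<in> sets borel"
  shows "emeasure (interval_measure f) E + emeasure (interval_measure h) E = emeasure lborel E"
proof -
  define m where "m = (\<lambda>E. emeasure (interval_measure f) E + emeasure (interval_measure h) E)"
  define N where "N = measure_of UNIV (sets borel) m"
  have sN: "sets N = sets borel"
    unfolding N_def using sets.sigma_sets_eq[of "borel :: real measure"] by simp
  have eN: "emeasure N X = m X" if "X \<in> sets borel" for X
    unfolding N_def
  proof (rule emeasure_measure_of_sigma)
    show "sigma_algebra UNIV (sets (borel :: real measure))"
      using sets.sigma_algebra_axioms[of "borel :: real measure"] by simp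
    show "positive (sets borel) m" by (simp add: positive_def m_def)
    show "countably_additive (sets borel) m"
      unfolding countably_additive_def m_def
      by (auto simp: suminf_add[symmetric] suminf_emeasure image_subset_iff)
    show "X \<in> sets borel" by fact
  qed
  have box: "emeasure (interval_measure g) {a<..<b} = ennreal (g b - g a)"
    if g: "mono g" "continuous_on UNIV g" and "a \<le> b" for g :: "real \<Rightarrow> real" and a b
  proof -
    have mono: "g u \<le> g v" if "u \<le> v" for u v using g(1) that by (simp add: monoD)
    have Icc: "emeasure (interval_measure g) {u..v} = g v - g u" if "u \<le> v" for u v
      using emeasure_interval_measure_Icc[of u v g] that mono g(2)
      by (auto intro: continuous_on_subset)
    have pt: "emeasure (interval_measure g) {u} = 0" for u using Icc[of u u] by simp
    have "emeasure (interval_measure g) {a<..<b} = emeasure (interval_measure g) ({a..b} - {a,b})"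
      by (rule arg_cong[where f="emeasure _"]) auto
    also have "\<dots> = emeasure (interval_measure g) {a..b}"
    proof (rule emeasure_Diff_null_set)
      have "{a} \<union> {b} \<in> null_sets (interval_measure g)"
        by (intro null_sets.Un) (auto simp: null_sets_def pt)
      then show "{a,b} \<in> null_sets (interval_measure g)" by (simp add: insert_commute)
    qed auto
    finally show ?thesis using Icc that by simp
  qed
  have "lborel = N"
  proof (rule lborel_eqI)
    fix l u :: real assume "\<And>b. b \<in> Basis \<Longrightarrow> l \<bullet> b \<le> u \<bullet> b"
    then have lu: "l \<le> u" by simp
    have "emeasure N (box l u) = ennreal (f u - f l) + ennreal (h u - h l)"
      using eN[of "box l u"] box[OF f lu] box[OF h lu] by (simp add: m_def box_real)
    also have "\<dots> = ennreal (u - l)"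
    proof -
      have "f l \<le> f u" "h l \<le> h u" using f h lu by (auto simp: monoD)
      then show ?thesis
        using sum[of u] sum[of l] by (subst ennreal_plus[symmetric]) (auto simp: algebra_simps)
    qed
    finally show "emeasure N (box l u) = (\<Prod>b\<in>Basis. (u - l) \<bullet> b)" by simp
  qed (fact sN)
  then show ?thesis using eN[OF E] by (simp add: m_def)
qed

text \<open>
  The assumption \<open>f x + h x = x\<close> with \<open>f\<close> and \<open>h\<close> monotone, in other words that \<open>f\<close> is monotone
  with slopes at most 1, bounds the measure of \<open>f\<close> by Lebesgue measure. Thus the null set that a
  Vitali covering of \<open>E\<close> by short intervals leaves uncovered is also null for the measure of \<open>f\<close>.
\<close>

lemma emeasure_interval_measure_le_slope:
  fixes f h :: "real \<Rightarrow> real"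
  assumes f: "mono f" "continuous_on UNIV f" and h: "mono h" "continuous_on UNIV h"
    and sum: "\<And>x. f x + h x = x" and E: "E \<in> sets borel" and p: "0 \<le> p"
    and slope: "\<And>x d. x \<in> E \<Longrightarrow> 0 < d \<Longrightarrow> \<exists>a b. a < x \<and> x < b \<and> b - a < d \<and> f b - f a < p * (b - a)"
  shows "emeasure (interval_measure f) E \<le> ennreal p * emeasure lborel E"
proof -
  let ?\<mu> = "emeasure (interval_measure f)" and ?l = "emeasure lborel"
  have \<mu>l: "?\<mu> X \<le> ?l X" if "X \<in> sets borel" for X
    using emeasure_add_interval_measure[OF f h sum that] by (metis le_iff_add)
  have "?\<mu> E \<le> ennreal p * (?l E + ennreal e)" if "e > 0" for e
  proof -
    obtain U where U: "open U" "E \<subseteq> U" "?l (U - E) < e"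
      using outer_regular_lborel[OF E \<open>e > 0\<close>] by blast
    define K where "K = {(a, b). a < b \<and> {a..b} \<subseteq> U \<and> f b - f a < p * (b - a)}"
    define c r where "c = (\<lambda>(a, b). (a + b) / 2 :: real)" and "r = (\<lambda>(a, b). (b - a) / 2 :: real)"
    have cb: "cball (c i) (r i) = {fst i..snd i}" for i
      by (cases i) (auto simp: c_def r_def cball_eq_atLeastAtMost field_simps)
    obtain C where C: "countable C" "C \<subseteq> K"
      "pairwise (\<lambda>i j. disjnt (cball (c i) (r i)) (cball (c j) (r j))) C"
      "negligible (E - (\<Union>i\<in>C. cball (c i) (r i)))"
    proof (rule Vitali_covering_theorem_cballs[of K r E c])
      show "0 < r i" if "i \<in> K" for i using that by (auto simp: K_def r_def)
      fix x d :: real assume x: "x \<in> E" "0 < d"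
      then obtain k where k: "0 < k" "ball x k \<subseteq> U" using U by (meson openE subsetD)
      obtain a b where ab: "a < x" "x < b" "b - a < min d k" "f b - f a < p * (b - a)"
        using slope[OF x(1), of "min d k"] x k by auto
      have "{a..b} \<subseteq> ball x k" using ab by (auto simp: dist_real_def)
      then have "(a, b) \<in> K" using ab k by (auto simp: K_def)
      then show "\<exists>i. i \<in> K \<and> x \<in> cball (c i) (r i) \<and> r i < d"
        using ab cb[of "(a, b)"] by (intro exI[of _ "(a, b)"]) (auto simp: r_def)
    qed (use that in blast)
    let ?W = "\<Union>i\<in>C. {fst i..snd i}"
    have Wm: "?W \<in> sets borel" using C(1) by (intro sets.countable_UN') auto
    have disj: "disjoint_family_on (\<lambda>i. {fst i..snd i}) C"
      using C(3) unfolding cb by (auto simp: disjoint_family_on_def pairwise_def disjnt_def)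
    have WU: "?W \<subseteq> U" using C(2) by (fastforce simp: K_def)
    have "?l (E - ?W) = 0"
      using C(4) E Wm unfolding cb negligible_iff_null_sets
      by (auto simp: null_sets_def)
    then have "?\<mu> (E - ?W) = 0" using \<mu>l[of "E - ?W"] E Wm by auto
    moreover have "?\<mu> E \<le> ?\<mu> (?W \<union> (E - ?W))" using E Wm by (intro emeasure_mono) auto
    moreover have "\<dots> \<le> ?\<mu> ?W + ?\<mu> (E - ?W)" using E Wm by (intro emeasure_subadditive) auto
    ultimately have "?\<mu> E \<le> ?\<mu> ?W" by simp
    also have "?\<mu> ?W = (\<integral>\<^sup>+i. ?\<mu> {fst i..snd i} \<partial>count_space C)"
      using C(1) disj by (intro emeasure_UN_countable) auto
    also have "\<dots> \<le> (\<integral>\<^sup>+i. ennreal p * ?l {fst i..snd i} \<partial>count_space C)"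
    proof (rule nn_integral_mono)
      fix i assume "i \<in> space (count_space C)"
      then have i: "fst i < snd i" "f (snd i) - f (fst i) < p * (snd i - fst i)"
        using C(2) by (auto simp: K_def)
      have "?\<mu> {fst i..snd i} = ennreal (f (snd i) - f (fst i))"
        using i f by (subst emeasure_interval_measure_Icc) (auto simp: monoD intro: continuous_on_subset)
      also have "\<dots> \<le> ennreal (p * (snd i - fst i))" using i by (intro ennreal_leI) auto
      finally show "?\<mu> {fst i..snd i} \<le> ennreal p * ?l {fst i..snd i}"
        using i p by (simp add: ennreal_mult)
    qed
    also have "\<dots> = ennreal p * (\<integral>\<^sup>+i. ?l {fst i..snd i} \<partial>count_space C)"
      by (rule nn_integral_cmult) auto
    also have "(\<integral>\<^sup>+i. ?l {fst i..snd i} \<partial>count_space C) = ?l ?W"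
      using C(1) disj by (intro emeasure_UN_countable[symmetric]) auto
    also have "?l ?W \<le> ?l (E \<union> (U - E))" using WU U E by (intro emeasure_mono) auto
    also have "\<dots> \<le> ?l E + ?l (U - E)" using U E by (intro emeasure_subadditive) auto
    also have "\<dots> \<le> ?l E + ennreal e" using U by (intro add_left_mono) auto
    finally show ?thesis by (simp add: mult_left_mono)
  qed
  then have *: "?\<mu> E \<le> ennreal p * ?l E + ennreal p * ennreal e" if "e > 0" for e
    using that by (simp add: distrib_left)
  show ?thesis
  proof (rule ennreal_le_epsilon)
    fix e :: real assume e: "0 < e"
    have "ennreal p * ennreal (e / (p + 1)) = ennreal (p * (e / (p + 1)))"
      using p e by (subst ennreal_mult[symmetric]) auto
    also have "\<dots> \<le> ennreal e" using p e by (intro ennreal_leI) (auto simp: field_simps)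
    finally show "?\<mu> E \<le> ennreal p * ?l E + ennreal e"
      using *[of "e / (p + 1)"] p e by (meson add_left_mono add_nonneg_pos divide_pos_pos order_trans zero_less_one)
  qed
qed

text \<open>
  Let \<open>E\<close> be a bounded set of points around which \<open>f\<close> has, on arbitrarily short intervals, both
  slopes below \<open>p\<close> and slopes above \<open>q\<close>, where \<open>p < q\<close>. The slopes of \<open>h\<close> on the intervals of the
  second kind are below \<open>1 - q\<close>. As the measures of \<open>f\<close> and \<open>h\<close> add up to Lebesgue measure, the
  previous lemma bounds the Lebesgue measure of \<open>E\<close> by \<open>p + (1 - q) < 1\<close> times itself, so \<open>E\<close> is null.
  Only open intervals around the points are used, which makes \<open>E\<close> a Borel set.
\<close>

lemma AE_differentiable_monotone_complement:
  fixes f h :: "real \<Rightarrow> real"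
  assumes f: "mono f" "continuous_on UNIV f" and h: "mono h" "continuous_on UNIV h"
    and sum: "\<And>x. f x + h x = x"
  shows "AE x in lborel. f differentiable (at x)"
proof -
  \<comment> \<open>the points with slopes below \<open>p\<close>, respectively above \<open>q\<close>, on arbitrarily short intervals\<close>
  define lo where "lo = (\<lambda>p. {x. \<forall>n::nat. \<exists>a b. a < x \<and> x < b \<and> b - a < 1 / Suc n \<and> f b - f a < p * (b - a)})"
  define hi where "hi = (\<lambda>q. {x. \<forall>n::nat. \<exists>a b. a < x \<and> x < b \<and> b - a < 1 / Suc n \<and> f b - f a > q * (b - a)})"
  have Suc: "\<exists>n::nat. 1 / Suc n < d" if "d > 0" for d :: real
    using nat_approx_posE[OF that] by metis
  have loD: "\<exists>a b. a < x \<and> x < b \<and> b - a < d \<and> f b - f a < p * (b - a)"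
    if "x \<in> lo p" "0 < d" for x p d
    using that Suc[OF that(2)] unfolding lo_def by (blast intro: less_trans)
  have hiD: "\<exists>a b. a < x \<and> x < b \<and> b - a < d \<and> f b - f a > q * (b - a)"
    if "x \<in> hi q" "0 < d" for x q d
    using that Suc[OF that(2)] unfolding hi_def by (blast intro: less_trans)
  have lo_m: "lo p \<in> sets borel" for p
  proof -
    have "lo p = (\<Inter>n::nat. \<Union>(a, b)\<in>{(a, b). b - a < 1 / Suc n \<and> f b - f a < p * (b - a)}. {a<..<b})"
      unfolding lo_def by (rule set_eqI) (simp, blast)
    moreover have "open (\<Union>(a, b)\<in>{(a, b). b - a < 1 / real (Suc n) \<and> f b - f a < p * (b - a)}. {a<..<b})" for n
      by (rule open_UN) auto
    ultimately show ?thesis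
      by (simp add: sets.countable_INT borel_open del: of_nat_Suc)
  qed
  have hi_m: "hi p \<in> sets borel" for p
  proof -
    have "hi p = (\<Inter>n::nat. \<Union>(a, b)\<in>{(a, b). b - a < 1 / Suc n \<and> f b - f a > p * (b - a)}. {a<..<b})"
      unfolding hi_def by (rule set_eqI) (simp, blast)
    moreover have "open (\<Union>(a, b)\<in>{(a, b). b - a < 1 / real (Suc n) \<and> f b - f a > p * (b - a)}. {a<..<b})" for n
      by (rule open_UN) auto
    ultimately show ?thesis
      by (simp add: sets.countable_INT borel_open del: of_nat_Suc)
  qed
  have null: "emeasure lborel (lo p \<inter> hi q \<inter> ball 0 (real n)) = 0" if pq: "p < q" for p q n
  proof (cases "lo p \<inter> hi q \<inter> ball 0 (real n) = {}")
    case False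
    let ?E = "lo p \<inter> hi q \<inter> ball 0 (real n)"
    obtain x where x: "x \<in> lo p" "x \<in> hi q" using False by blast
    have inc: "f a \<le> f b" "h a \<le> h b" if "a \<le> b" for a b using f h that by (auto simp: monoD)
    have p: "0 < p"
    proof -
      obtain a b where ab: "a < b" "f b - f a < p * (b - a)"
        using loD[OF x(1), of 1] by (meson less_trans zero_less_one)
      then have "0 < p * (b - a)" using inc(1)[of a b] by linarith
      then show ?thesis using ab by (simp add: zero_less_mult_iff)
    qed
    have q: "0 < 1 - q"
    proof -
      obtain a b where ab: "a < b" "f b - f a > q * (b - a)"
        using hiD[OF x(2), of 1] by (meson less_trans zero_less_one)
      then have "0 < (1 - q) * (b - a)"
        using inc(2)[of a b] sum[of a] sum[of b] by (simp add: algebra_simps)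
      then show ?thesis using ab by (simp add: zero_less_mult_iff)
    qed
    have E: "?E \<in> sets borel" using lo_m hi_m by auto
    have fin: "emeasure lborel ?E \<noteq> \<infinity>"
    proof -
      have "emeasure lborel ?E \<le> emeasure lborel (ball 0 (real n) :: real set)"
        by (intro emeasure_mono) auto
      also have "\<dots> < \<infinity>" using emeasure_lborel_ball_finite by simp
      finally show ?thesis by simp
    qed
    then obtain m where m: "emeasure lborel ?E = ennreal m" "0 \<le> m"
      by (cases "emeasure lborel ?E") auto
    have 1: "emeasure (interval_measure f) ?E \<le> ennreal p * emeasure lborel ?E"
      by (rule emeasure_interval_measure_le_slope[OF f h sum E]) (use loD p in auto)
    have 2: "emeasure (interval_measure h) ?E \<le> ennreal (1 - q) * emeasure lborel ?E"
    proof (rule emeasure_interval_measure_le_slope[OF h f _ E])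
      fix x d :: real assume "x \<in> ?E" "0 < d"
      then obtain a b where ab: "a < x" "x < b" "b - a < d" "f b - f a > q * (b - a)"
        using hiD[of x q d] by auto
      then have "h b - h a < (1 - q) * (b - a)"
        using sum[of a] sum[of b] by (simp add: algebra_simps)
      then show "\<exists>a b. a < x \<and> x < b \<and> b - a < d \<and> h b - h a < (1 - q) * (b - a)"
        using ab by blast
    qed (use q sum in \<open>auto simp: add.commute\<close>)
    have "ennreal m \<le> ennreal p * ennreal m + ennreal (1 - q) * ennreal m"
      using add_mono[OF 1 2] emeasure_add_interval_measure[OF f h sum E] m by simp
    also have "\<dots> = ennreal (p * m + (1 - q) * m)"
      using p q m by (simp add: ennreal_mult)
    finally have "m \<le> p * m + (1 - q) * m"
      using p q m by (subst (asm) ennreal_le_iff) auto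
    then have "(q - p) * m \<le> 0" by (simp add: algebra_simps)
    then have "m \<le> 0" using pq by (simp add: mult_le_0_iff)
    then show ?thesis using m by simp
  qed simp
  have "AE x in lborel. x \<notin> lo p \<inter> hi q \<inter> ball 0 (real n)" if "p < q" for p q n
    using null[OF that, of n] lo_m hi_m
    by (intro AE_not_in) (auto simp: null_sets_def)
  then have "AE x in lborel. \<forall>p\<in>\<rat>. \<forall>q\<in>\<rat>. \<forall>n. p < q \<longrightarrow> x \<notin> lo p \<inter> hi q \<inter> ball 0 (real n)"
    unfolding AE_ball_countable[OF countable_rat] AE_all_countable
    by (metis (mono_tags, lifting) AE_I2 eventually_mono)
  then show ?thesis
  proof (rule AE_mp, intro AE_I2 impI)
    fix x :: real
    assume *: "\<forall>p\<in>\<rat>. \<forall>q\<in>\<rat>. \<forall>n. p < q \<longrightarrow> x \<notin> lo p \<inter> hi q \<inter> ball 0 (real n)"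
    obtain n where "\<bar>x\<bar> < real n" using reals_Archimedean2 by blast
    then have not: "x \<notin> lo p \<or> x \<notin> hi q" if "p \<in> \<rat>" "q \<in> \<rat>" "p < q" for p q
      using *[rule_format, OF that, of n] by (auto simp: dist_real_def)
    have sl: "0 \<le> f b - f a" "f b - f a \<le> b - a" if "a \<le> b" for a b
      using f(1) monoD[OF h(1) that] that sum[of a] sum[of b] by (auto simp: monoD)
    define P where "P = {p \<in> \<rat>. x \<in> lo p}"
    have "2 \<in> P"
    proof -
      have "\<exists>a b. a < x \<and> x < b \<and> b - a < 1 / Suc n \<and> f b - f a < 2 * (b - a)" for n
      proof -
        define k where "k = 1 / (4 * real (Suc n))"
        have k: "0 < k" by (simp add: k_def)
        have "4 * k = 1 / real (Suc n)" by (simp add: k_def field_simps)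
        then have "(x + k) - (x - k) < 1 / real (Suc n)" using k by linarith
        moreover have "x - k < x" "x < x + k" using k by linarith+
        moreover have "x - k \<le> x + k" using k by linarith
        from sl(2)[OF this] have "f (x + k) - f (x - k) < 2 * ((x + k) - (x - k))"
          by (rule order.strict_trans1) (use k in simp)
        ultimately show ?thesis by blast
      qed
      then show ?thesis by (simp add: P_def lo_def)
    qed
    have P0: "0 \<le> p" if "p \<in> P" for p
    proof -
      obtain a b where ab: "a < b" "f b - f a < p * (b - a)"
        using loD[of x p 1] \<open>p \<in> P\<close> unfolding P_def by (auto dest: less_trans)
      then have "0 < p * (b - a)" using sl(1)[of a b] by linarith
      then show ?thesis using ab by (simp add: zero_less_mult_iff)
    qed
    define d where "d = Inf P"
    have bdd: "bdd_below P" unfolding bdd_below_def using P0 by blast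
    \<comment> \<open>slopes over open intervals around \<open>x\<close> converge to \<open>d\<close>\<close>
    have conv: "\<exists>k>0. \<forall>a b. a < x \<and> x < b \<and> b - a < k \<longrightarrow>
        (d - e) * (b - a) \<le> f b - f a \<and> f b - f a \<le> (d + e) * (b - a)" if e: "e > 0" for e
    proof -
      obtain p where p: "p \<in> P" "p < d + e"
        using cInf_less_iff[of P "d + e"] \<open>2 \<in> P\<close> bdd e by (auto simp: d_def)
      obtain q where q: "q \<in> \<rat>" "p < q" "q < d + e" using Rats_dense_in_real[OF p(2)] by auto
      obtain q' where q': "q' \<in> \<rat>" "d - e < q'" "q' < d"
        using Rats_dense_in_real[of "d - e" d] e by auto
      have "x \<notin> hi q" using not[of p q] p q by (auto simp: P_def)
      then obtain n1 :: nat where n1: "\<And>a b. a < x \<Longrightarrow> x < b \<Longrightarrow> b - a < 1 / Suc n1 \<Longrightarrow> f b - f a \<le> q * (b - a)"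
        unfolding hi_def by (force simp: not_less)
      have "q' \<notin> P" using cInf_lower[OF _ bdd, of q'] q' by (auto simp: d_def)
      then have "x \<notin> lo q'" using q' by (auto simp: P_def)
      then obtain n2 :: nat where n2: "\<And>a b. a < x \<Longrightarrow> x < b \<Longrightarrow> b - a < 1 / Suc n2 \<Longrightarrow> f b - f a \<ge> q' * (b - a)"
        unfolding lo_def by (force simp: not_less)
      show ?thesis
      proof (intro exI[of _ "min (1 / Suc n1) (1 / Suc n2)"] conjI allI impI)
        fix a b assume ab: "a < x \<and> x < b \<and> b - a < min (1 / real (Suc n1)) (1 / real (Suc n2))"
        have "(d - e) * (b - a) \<le> q' * (b - a)" using q' ab by (intro mult_right_mono) auto
        also have "\<dots> \<le> f b - f a" using ab by (intro n2) auto
        finally show "(d - e) * (b - a) \<le> f b - f a" .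
        have "f b - f a \<le> q * (b - a)" using ab by (intro n1) auto
        also have "\<dots> \<le> (d + e) * (b - a)" using q ab by (intro mult_right_mono) auto
        finally show "f b - f a \<le> (d + e) * (b - a)" .
      qed simp
    qed
    have "(f has_derivative (\<lambda>y. d * y)) (at x)"
      unfolding has_derivative_at_alt
    proof (intro conjI allI impI)
      show "bounded_linear (\<lambda>y. d * y)" by (rule bounded_linear_mult_right)
      fix e :: real assume e: "0 < e"
      obtain k where k: "k > 0" "\<And>a b. a < x \<Longrightarrow> x < b \<Longrightarrow> b - a < k \<Longrightarrow>
        (d - e) * (b - a) \<le> f b - f a \<and> f b - f a \<le> (d + e) * (b - a)"
        using conv[OF e] by blast
      have cf: "isCont f z" for z using f(2) by (simp add: continuous_on_eq_continuous_at)
      \<comment> \<open>by continuity, \<open>x\<close> may also be an endpoint of the interval\<close>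
      have le: "(d - e) * (b - a) \<le> f b - f a \<and> f b - f a \<le> (d + e) * (b - a)"
        if ab: "a \<le> x" "x \<le> b" "b - a < k" for a b
      proof -
        have t: "((\<lambda>t. a - t) \<longlongrightarrow> a) (at_right 0)" "((\<lambda>t. b + t) \<longlongrightarrow> b) (at_right 0)"
          by (auto intro!: tendsto_eq_intros)
        have ev: "\<forall>\<^sub>F t in at_right 0. a - t < x \<and> x < b + t \<and> (b + t) - (a - t) < k"
          unfolding eventually_at_right_field using ab
          by (intro exI[of _ "(k - (b - a)) / 2"]) (auto simp: field_simps)
        have tf: "((\<lambda>t. f (b + t) - f (a - t)) \<longlongrightarrow> f b - f a) (at_right 0)"
          by (intro tendsto_diff isCont_tendsto_compose[OF cf] t)
        have tl: "((\<lambda>t. c * ((b + t) - (a - t))) \<longlongrightarrow> c * (b - a)) (at_right 0)" for c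
          by (intro tendsto_intros t)
        have "(d - e) * (b - a) \<le> f b - f a"
          by (rule tendsto_le[OF _ tf tl]) (simp, rule eventually_mono[OF ev], use k(2) in blast)
        moreover have "f b - f a \<le> (d + e) * (b - a)"
          by (rule tendsto_le[OF _ tl tf]) (simp, rule eventually_mono[OF ev], use k(2) in blast)
        ultimately show ?thesis by blast
      qed
      show "\<exists>k>0. \<forall>y. norm (y - x) < k \<longrightarrow> norm (f y - f x - d * (y - x)) \<le> e * norm (y - x)"
      proof (intro exI[of _ k] conjI allI impI)
        fix y assume y: "norm (y - x) < k"
        show "norm (f y - f x - d * (y - x)) \<le> e * norm (y - x)"
        proof (cases "x \<le> y")
          case True
          then show ?thesis using le[of x y] y by (auto simp: abs_le_iff algebra_simps)
        next
          case False
          then show ?thesis using le[of y x] y by (auto simp: abs_le_iff algebra_simps)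
        qed
      qed (fact k)
    qed
    then show "f differentiable (at x)" by (auto simp: differentiable_def)
  qed
qed

lemma AE_differentiable_lipschitz_real:
  fixes g :: "real \<Rightarrow> real"
  assumes "C-lipschitz_on UNIV g"
  shows "AE x in lborel. g differentiable (at x)"
proof -
  define L where "L = C + 1"
  have L: "L > 0" "\<bar>g x - g y\<bar> \<le> L * \<bar>x - y\<bar>" for x y
  proof -
    show "L > 0" using lipschitz_on_nonneg[OF assms] by (simp add: L_def)
    have "\<bar>g x - g y\<bar> \<le> C * \<bar>x - y\<bar>"
      using lipschitz_onD[OF assms, of x y] by (simp add: dist_real_def)
    then show "\<bar>g x - g y\<bar> \<le> L * \<bar>x - y\<bar>" by (simp add: L_def algebra_simps)
  qed
  have bd: "\<bar>g x / L - g y / L\<bar> \<le> \<bar>x - y\<bar>" for x y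
  proof -
    have "g x / L - g y / L = (g x - g y) / L" by (simp add: diff_divide_distrib)
    then have "\<bar>g x / L - g y / L\<bar> = \<bar>g x - g y\<bar> / L" using L(1) by simp
    then show ?thesis using L(1) L(2)[of x y] by (simp add: pos_divide_le_eq mult.commute)
  qed
  have gc: "continuous_on UNIV g" using assms by (rule lipschitz_on_continuous_on)
  \<comment> \<open>both \<open>x + g x / L\<close> and \<open>x - g x / L\<close> are monotone\<close>
  have "AE x in lborel. (\<lambda>x. (x + g x / L) / 2) differentiable (at x)"
  proof (rule AE_differentiable_monotone_complement[where h = "\<lambda>x. (x - g x / L) / 2"])
    show "mono (\<lambda>x. (x + g x / L) / 2)" "mono (\<lambda>x. (x - g x / L) / 2)"
    proof -
      have bd': "g x / L - g y / L \<le> y - x" "g y / L - g x / L \<le> y - x" if "x \<le> y" for x y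
        using bd[of x y] that by linarith+
      have "(x + g x / L) / 2 \<le> (y + g y / L) / 2 \<and> (x - g x / L) / 2 \<le> (y - g y / L) / 2"
        if "x \<le> y" for x y
        using bd'[OF that] by (intro conjI divide_right_mono) linarith+
      then show "mono (\<lambda>x. (x + g x / L) / 2)" "mono (\<lambda>x. (x - g x / L) / 2)"
        by (auto intro!: monoI)
    qed
    show "continuous_on UNIV (\<lambda>x. (x + g x / L) / 2)" "continuous_on UNIV (\<lambda>x. (x - g x / L) / 2)"
      using L by (auto intro!: continuous_intros gc)
  qed (simp add: field_simps)
  then show ?thesis
  proof (rule AE_mp, intro AE_I2 impI)
    fix x assume "(\<lambda>x. (x + g x / L) / 2) differentiable (at x)"
    then have "(\<lambda>x. L * (2 * ((x + g x / L) / 2) - x)) differentiable (at x)"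
      by (intro differentiable_mult differentiable_diff differentiable_const differentiable_ident)
    moreover have "(\<lambda>x. L * (2 * ((x + g x / L) / 2) - x)) = g"
      using L(1) by (auto simp: fun_eq_iff field_simps)
    ultimately show "g differentiable (at x)" by argo
  qed
qed

lemma AE_differentiable_lipschitz:
  fixes \<phi> :: "real \<Rightarrow> 'a::euclidean_space"
  assumes "C-lipschitz_on UNIV \<phi>"
  shows "AE x in lborel. \<phi> differentiable (at x)"
proof -
  have "AE x in lborel. (\<lambda>t. \<phi> t \<bullet> b) differentiable (at x)" if "b \<in> Basis" for b
  proof (rule AE_differentiable_lipschitz_real[of C])
    show "C-lipschitz_on UNIV (\<lambda>t. \<phi> t \<bullet> b)"
    proof (rule lipschitz_onI)
      fix s t :: real
      have "dist (\<phi> s \<bullet> b) (\<phi> t \<bullet> b) = \<bar>(\<phi> s - \<phi> t) \<bullet> b\<bar>"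
        by (simp add: dist_real_def inner_diff_left)
      also have "\<dots> \<le> dist (\<phi> s) (\<phi> t)" using Basis_le_norm[OF that] by (simp add: dist_norm)
      also have "\<dots> \<le> C * dist s t" using lipschitz_onD[OF assms] by simp
      finally show "dist (\<phi> s \<bullet> b) (\<phi> t \<bullet> b) \<le> C * dist s t" .
    qed (use lipschitz_on_nonneg[OF assms] in simp)
  qed
  then have "AE x in lborel. \<forall>b\<in>Basis. (\<lambda>t. \<phi> t \<bullet> b) differentiable (at x)"
    by (intro AE_ball_countable') (auto simp: countable_finite)
  then show ?thesis
  proof (rule eventually_mono)
    fix x assume "\<forall>b\<in>Basis. (\<lambda>t. \<phi> t \<bullet> b) differentiable (at x)"
    then show "\<phi> differentiable (at x)" using differentiable_componentwise_within by blast
  qed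
qed

section \<open>Lipschitz parameterizations of curves\<close>

text \<open>
  The paths on \<open>{0..1}\<close> in \<open>K\<close> from \<open>a\<close> to \<open>b\<close> with Lipschitz constant \<open>M\<close>. Values outside
  \<open>{0..1}\<close> are arbitrary.
\<close>

definition lipschitz_paths ::
  "real \<Rightarrow> (real ^ 'n) set \<Rightarrow> real ^ 'n \<Rightarrow> real ^ 'n \<Rightarrow> (real \<Rightarrow> real ^ ('n::finite)) set" where
  "lipschitz_paths M K a b =
     {\<phi>. M-lipschitz_on {0..1} \<phi> \<and> \<phi> ` {0..1} \<subseteq> K \<and> \<phi> 0 = a \<and> \<phi> 1 = b}"

lemma frechet_rel_time_change:
  assumes p: "(T, \<psi>) \<in> params G" and a: "\<alpha> \<in> time_changes T"
  shows "((T, \<psi>), (1, \<psi> \<circ> \<alpha>)) \<in> frechet_rel G"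
proof -
  note al = time_changesD[OF a]
  have q: "(1, \<psi> \<circ> \<alpha>) \<in> params G"
    using p al continuous_on_compose[OF al(1), of \<psi>] by (auto simp: params_def)
  have "frechet_dist (T, \<psi>) (1, \<psi> \<circ> \<alpha>) = 0"
    unfolding frechet_dist_eq_0_iff[OF p q]
    using a linear_time_change[of 1] by (intro allI impI bexI[OF _ a] bexI[of _ "\<lambda>s. 1 * s"]) auto
  then show ?thesis using p q by (simp add: frechet_rel_def)
qed

text \<open>Inequality suffices below, and unlike equality it needs no common refinement of partitions.\<close>

lemma param_length_extend:
  assumes "0 \<le> s" "s \<le> t"
  shows "param_length (s, \<phi>) + ennreal (dist (\<phi> s) (\<phi> t)) \<le> param_length (t, \<phi>)"
proof -
  define I where "I = (\<lambda>T::real. {(m :: nat, t :: nat \<Rightarrow> real). (\<forall>i\<le>m. t i \<in> {0..T}) \<and> (\<forall>i<m. t i \<le> t (Suc i))})"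
  define F where "F = (\<lambda>(m :: nat, t). ennreal (\<Sum>i<m. dist (\<phi> (t i)) (\<phi> (t (Suc i)))))"
  have pl: "param_length (T, \<phi>) = (SUP x\<in>I T. F x)" for T
    by (simp add: param_length_def I_def F_def)
  have "(0, \<lambda>_. 0) \<in> I s" using assms by (auto simp: I_def)
  then have ne: "I s \<noteq> {}" by blast
  have "(SUP x\<in>I s. F x) + ennreal (dist (\<phi> s) (\<phi> t)) = (SUP x\<in>I s. F x + ennreal (dist (\<phi> s) (\<phi> t)))"
    using ne by (simp add: ennreal_SUP_add_left)
  also have "\<dots> \<le> (SUP x\<in>I t. F x)"
  proof (rule SUP_least)
    fix x assume x: "x \<in> I s"
    obtain m u where xm: "x = (m, u)" by (cases x)
    have u: "\<forall>i\<le>m. u i \<in> {0..s}" "\<forall>i<m. u i \<le> u (Suc i)" using x by (auto simp: I_def xm)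
    define u' where "u' = (\<lambda>i. if i \<le> m then u i else if i = Suc m then s else t)"
    have "(Suc (Suc m), u') \<in> I t"
      using u assms by (force simp: I_def u'_def le_Suc_eq less_Suc_eq)
    then have "F (Suc (Suc m), u') \<le> (SUP x\<in>I t. F x)" by (rule SUP_upper)
    moreover have "F x + ennreal (dist (\<phi> s) (\<phi> t)) \<le> F (Suc (Suc m), u')"
    proof -
      have "(\<Sum>i<m. dist (\<phi> (u' i)) (\<phi> (u' (Suc i)))) = (\<Sum>i<m. dist (\<phi> (u i)) (\<phi> (u (Suc i))))"
        by (intro sum.cong) (auto simp: u'_def)
      then have "(\<Sum>i<Suc (Suc m). dist (\<phi> (u' i)) (\<phi> (u' (Suc i))))
          \<ge> (\<Sum>i<m. dist (\<phi> (u i)) (\<phi> (u (Suc i)))) + dist (\<phi> s) (\<phi> t)"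
        by (simp add: u'_def)
      then show ?thesis
        by (simp add: F_def xm sum_nonneg flip: ennreal_plus)
    qed
    ultimately show "F x + ennreal (dist (\<phi> s) (\<phi> t)) \<le> (SUP x\<in>I t. F x)" by (rule order_trans[rotated])
  qed
  finally show ?thesis by (simp add: pl)
qed

text \<open>
  With \<open>v t\<close> the length of \<open>\<psi>\<close> on \<open>{0..t}\<close>, the new parameter is \<open>\<sigma> t = v t - v 0 + \<delta> * t\<close>. The
  term \<open>\<delta> * t\<close> makes the left inverse \<open>g\<close> of \<open>\<sigma>\<close> Lipschitz, also where \<open>\<psi>\<close> is constant, and \<open>\<delta>\<close> is
  chosen such that \<open>\<sigma> T \<le> M\<close>. Continuity of \<open>v\<close> is not needed: \<open>g\<close> is constant across the
  jumps that \<open>\<sigma>\<close> might have.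
\<close>

lemma lipschitz_reparametrization:
  assumes p: "(T, \<psi>) \<in> params G" and len: "param_length (T, \<psi>) < ennreal M"
  obtains \<phi> where "((T, \<psi>), (1, \<phi>)) \<in> frechet_rel G" "M-lipschitz_on {0..1} \<phi>"
proof -
  have T: "0 < T" and cont: "continuous_on {0..T} \<psi>" using p by (auto simp: params_def)
  define v where "v = (\<lambda>t. enn2real (param_length (t, \<psi>)))"
  have fin: "param_length (t, \<psi>) < top" if "t \<in> {0..T}" for t
  proof -
    have "param_length (t, \<psi>) \<le> param_length (t, \<psi>) + ennreal (dist (\<psi> t) (\<psi> T))" by simp
    also have "\<dots> \<le> param_length (T, \<psi>)" using that by (intro param_length_extend) auto
    also have "\<dots> < top" using len by (rule less_trans) simp
    finally show ?thesis .
  qed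
  have v: "v s + dist (\<psi> s) (\<psi> t) \<le> v t" if "0 \<le> s" "s \<le> t" "t \<le> T" for s t
  proof -
    have e: "param_length (s, \<psi>) = ennreal (v s)" "param_length (t, \<psi>) = ennreal (v t)"
      using fin[of s] fin[of t] that by (auto simp: v_def)
    have "ennreal (v s + dist (\<psi> s) (\<psi> t)) \<le> ennreal (v t)"
      using param_length_extend[of s t \<psi>] that unfolding e by (simp add: ennreal_plus v_def)
    then show ?thesis by (subst (asm) ennreal_le_iff) (simp_all add: v_def)
  qed
  have vM: "v T < M"
  proof -
    have "ennreal (v T) < ennreal M" using len fin[of T] T by (simp add: v_def)
    then show ?thesis by (simp add: ennreal_less_iff v_def)
  qed
  define \<delta> where "\<delta> = (M - v T) / T"
  have \<delta>: "\<delta> > 0" "\<delta> * T = M - v T" using T vM by (auto simp: \<delta>_def)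
  define \<sigma> where "\<sigma> = (\<lambda>t. v t - v 0 + \<delta> * t)"
  have \<sigma>: "dist (\<psi> s) (\<psi> t) + \<delta> * (t - s) \<le> \<sigma> t - \<sigma> s" if "0 \<le> s" "s \<le> t" "t \<le> T" for s t
    using v[OF that] by (simp add: \<sigma>_def algebra_simps)
  define w where "w = \<sigma> T"
  have w: "0 < w" "w \<le> M"
  proof -
    have "0 < \<delta> * T" using \<delta>(1) T by (rule mult_pos_pos)
    moreover have "\<sigma> 0 = 0" by (simp add: \<sigma>_def)
    moreover have "dist (\<psi> 0) (\<psi> T) + \<delta> * (T - 0) \<le> \<sigma> T - \<sigma> 0" using T by (intro \<sigma>) auto
    ultimately show "0 < w"
      using zero_le_dist[of "\<psi> 0" "\<psi> T"] unfolding w_def diff_zero by linarith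
    show "w \<le> M" using \<delta>(2) enn2real_nonneg[of "param_length (0, \<psi>)"]
      unfolding w_def \<sigma>_def v_def by linarith
  qed
  \<comment> \<open>the McShane extension of the inverse of \<open>\<sigma>\<close> from the range of \<open>\<sigma>\<close> to the real line, in a
      monotone version\<close>
  define h where "h = (\<lambda>u t. t + max 0 ((u - \<sigma> t) / \<delta>))"
  define g where "g = (\<lambda>u. INF t\<in>{0..T}. h u t)"
  have ne: "{0..T} \<noteq> {}" using T by simp
  have bdd: "bdd_below (h u ` {0..T})" for u
    unfolding bdd_below_def by (intro exI[of _ 0]) (auto simp: h_def)
  have g\<sigma>: "g (\<sigma> t) = t" if t: "t \<in> {0..T}" for t
  proof (rule antisym)
    have "g (\<sigma> t) \<le> h (\<sigma> t) t" unfolding g_def using bdd t by (rule cINF_lower)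
    then show "g (\<sigma> t) \<le> t" by (simp add: h_def)
    show "t \<le> g (\<sigma> t)" unfolding g_def
    proof (rule cINF_greatest[OF ne])
      fix s assume s: "s \<in> {0..T}"
      show "t \<le> h (\<sigma> t) s"
      proof (cases "s \<le> t")
        case True
        have "\<delta> * (t - s) \<le> dist (\<psi> s) (\<psi> t) + \<delta> * (t - s)" by simp
        also have "\<dots> \<le> \<sigma> t - \<sigma> s" using \<sigma>[of s t] s t True by simp
        finally have "t - s \<le> (\<sigma> t - \<sigma> s) / \<delta>" using \<delta> by (simp add: field_simps)
        then show ?thesis by (simp add: h_def)
      qed (auto simp: h_def)
    qed
  qed
  have gmono: "g u \<le> g u'" if "u \<le> u'" for u u'
    unfolding g_def
  proof (rule cINF_mono[OF ne bdd])
    fix t assume t: "t \<in> {0..T}"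
    have "(u - \<sigma> t) / \<delta> \<le> (u' - \<sigma> t) / \<delta>" using that \<delta> by (intro divide_right_mono) auto
    then have "h u t \<le> h u' t" by (auto simp: h_def)
    then show "\<exists>n\<in>{0..T}. h u n \<le> h u' t" using t by blast
  qed
  have gexp: "g u' \<le> g u + (u' - u) / \<delta>" if "u \<le> u'" for u u'
  proof -
    have "g u' - (u' - u) / \<delta> \<le> g u"
      unfolding g_def
    proof (rule cINF_greatest[OF ne])
      fix t assume t: "t \<in> {0..T}"
      have 1: "g u' \<le> h u' t" unfolding g_def using bdd t by (rule cINF_lower)
      have "(u' - \<sigma> t) / \<delta> = (u - \<sigma> t) / \<delta> + (u' - u) / \<delta>"
        by (simp add: diff_divide_distrib)
      moreover have "0 \<le> (u' - u) / \<delta>" using that \<delta> by simp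
      ultimately have "h u' t \<le> h u t + (u' - u) / \<delta>" unfolding h_def by linarith
      then show "(INF t\<in>{0..T}. h u' t) - (u' - u) / \<delta> \<le> h u t" using 1 unfolding g_def by linarith
    qed
    then show ?thesis by simp
  qed
  have gcont: "continuous_on A g" for A
  proof (rule lipschitz_on_continuous_on)
    show "(1 / \<delta>)-lipschitz_on A g"
    proof (rule lipschitz_onI)
      fix u u' :: real
      have *: "dist (g u) (g u') \<le> 1 / \<delta> * dist u u'" if "u \<le> u'" for u u'
        using gmono[OF that] gexp[OF that] that by (simp add: dist_real_def)
      show "dist (g u) (g u') \<le> 1 / \<delta> * dist u u'"
        using *[of u u'] *[of u' u] by (cases "u \<le> u'") (auto simp: dist_commute)
    qed (use \<delta> in simp)
  qed
  have g0: "g 0 = 0" using g\<sigma>[of 0] T by (simp add: \<sigma>_def)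
  have gw: "g w = T" using g\<sigma>[of T] T by (simp add: w_def)
  define \<alpha> where "\<alpha> = (\<lambda>s. g (w * s))"
  have tc: "\<alpha> \<in> time_changes T"
    unfolding time_changes_def
  proof (intro CollectI conjI)
    show "continuous_on {0..1} \<alpha>" unfolding \<alpha>_def
      by (intro continuous_on_compose2[OF gcont[of UNIV]] continuous_intros) auto
    show "mono_on {0..1} \<alpha>" unfolding \<alpha>_def
      using w by (intro mono_onI gmono) auto
    have "0 \<le> \<alpha> s \<and> \<alpha> s \<le> T" if "s \<in> {0..1}" for s
      using gmono[of 0 "w * s"] gmono[of "w * s" w] g0 gw w that
      by (auto simp: \<alpha>_def mult_left_le)
    moreover have "\<exists>s\<in>{0..1}. \<alpha> s = t" if "t \<in> {0..T}" for t
    proof (intro bexI[of _ "\<sigma> t / w"])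
      show "\<alpha> (\<sigma> t / w) = t" using g\<sigma>[OF that] w by (simp add: \<alpha>_def)
      have d: "0 \<le> dist (\<psi> 0) (\<psi> t) + \<delta> * (t - 0)" "0 \<le> dist (\<psi> t) (\<psi> T) + \<delta> * (T - t)"
        using \<delta> that by auto
      have "0 \<le> \<sigma> t" "\<sigma> t \<le> w"
        using order_trans[OF d(1) \<sigma>[of 0 t]] order_trans[OF d(2) \<sigma>[of t T]] that
        by (auto simp: w_def) (simp add: \<sigma>_def)
      then show "\<sigma> t / w \<in> {0..1}" using w by simp
    qed
    ultimately show "\<alpha> ` {0..1} = {0..T}" by (auto simp: image_iff) metis
  qed
  have lip: "dist (\<psi> (g u)) (\<psi> (g u')) \<le> u' - u" if u: "0 \<le> u" "u \<le> u'" "u' \<le> w" for u u'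
  proof (cases "g u = g u'")
    case False
    define a b where "a = g u" and "b = g u'"
    have ab: "a < b" "0 \<le> a" "b \<le> T"
      using gmono[of u u'] gmono[of 0 u] gmono[of u' w] u False g0 gw by (auto simp: a_def b_def)
    \<comment> \<open>strictly between \<open>a\<close> and \<open>b\<close> the values of \<open>\<sigma>\<close> lie between \<open>u\<close> and \<open>u'\<close>; at \<open>a\<close> and \<open>b\<close>
        this may fail, so these points are approached by sequences\<close>
    define s t where "s = (\<lambda>n::nat. a + (b - a) * inverse (real (Suc n + 2)))"
      and "t = (\<lambda>n::nat. b - (b - a) * inverse (real (Suc n + 2)))"
    have st: "a < s n" "s n < t n" "t n < b" for n
    proof -
      define k where "k = inverse (real (Suc n + 2))"
      have k: "0 < k" "k < 1/2" by (auto simp: k_def field_simps)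
      define q where "q = (b - a) * k"
      have q: "0 < q" "2 * q < b - a"
        using ab k mult_strict_left_mono[of "2 * k" 1 "b - a"] by (simp_all add: q_def)
      have "s n = a + q" "t n = b - q" by (simp_all only: s_def t_def q_def k_def)
      then show "a < s n" "s n < t n" "t n < b" using q by linarith+
    qed
    have le: "dist (\<psi> (s n)) (\<psi> (t n)) \<le> u' - u" for n
    proof -
      have in0: "s n \<in> {0..T}" "t n \<in> {0..T}" using st[of n] ab by auto
      have "u < \<sigma> (s n)"
      proof (rule ccontr)
        assume "\<not> u < \<sigma> (s n)"
        then have "s n \<le> a" using gmono[of "\<sigma> (s n)" u] g\<sigma>[OF in0(1)] by (simp add: a_def)
        then show False using st(1)[of n] by simp
      qed
      moreover have "\<sigma> (t n) < u'"
      proof (rule ccontr)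
        assume "\<not> \<sigma> (t n) < u'"
        then have "b \<le> t n" using gmono[of u' "\<sigma> (t n)"] g\<sigma>[OF in0(2)] by (simp add: b_def)
        then show False using st(3)[of n] by simp
      qed
      moreover have "dist (\<psi> (s n)) (\<psi> (t n)) \<le> \<sigma> (t n) - \<sigma> (s n)"
      proof -
        have "0 \<le> \<delta> * (t n - s n)" using st(2)[of n] \<delta> by simp
        then show ?thesis using \<sigma>[of "s n" "t n"] in0 st(2)[of n] by auto
      qed
      ultimately show ?thesis by linarith
    qed
    have lim0: "(\<lambda>n. inverse (real (Suc n + 2))) \<longlonglongrightarrow> 0"
      using LIMSEQ_ignore_initial_segment[OF LIMSEQ_inverse_real_of_nat, of 2] by simp
    have "s \<longlonglongrightarrow> a + (b - a) * 0" "t \<longlonglongrightarrow> b - (b - a) * 0"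
      unfolding s_def t_def by (intro tendsto_intros lim0)+
    then have lims: "s \<longlonglongrightarrow> a" "t \<longlonglongrightarrow> b" by auto
    have in1: "s n \<in> {0..T}" "t n \<in> {0..T}" for n using st[of n] ab by auto
    have in2: "a \<in> {0..T}" "b \<in> {0..T}" using ab by auto
    have lims2: "(\<lambda>n. \<psi> (s n)) \<longlonglongrightarrow> \<psi> a" "(\<lambda>n. \<psi> (t n)) \<longlonglongrightarrow> \<psi> b"
      by (rule continuous_on_tendsto_compose[OF cont lims(1) in2(1)], use in1 in auto)
         (rule continuous_on_tendsto_compose[OF cont lims(2) in2(2)], use in1 in auto)
    have "dist (\<psi> a) (\<psi> b) \<le> u' - u"
      by (rule LIMSEQ_le_const2[OF tendsto_dist[OF lims2]]) (use le in blast)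
    then show ?thesis by (simp add: a_def b_def)
  qed (use u in simp)
  have "M-lipschitz_on {0..1} (\<psi> \<circ> \<alpha>)"
  proof (rule lipschitz_onI)
    have *: "dist ((\<psi> \<circ> \<alpha>) s) ((\<psi> \<circ> \<alpha>) t) \<le> M * dist s t"
      if "s \<in> {0..1}" "t \<in> {0..1}" "s \<le> t" for s t
    proof -
      have "dist ((\<psi> \<circ> \<alpha>) s) ((\<psi> \<circ> \<alpha>) t) \<le> w * t - w * s"
        unfolding \<alpha>_def o_def using w that by (intro lip) (auto simp: mult_left_le)
      also have "\<dots> = w * (t - s)" by (simp add: algebra_simps)
      also have "\<dots> \<le> M * (t - s)" using w that by (intro mult_right_mono) auto
      finally show ?thesis using that by (simp add: dist_real_def)
    qed
    fix s t :: real assume "s \<in> {0..1}" "t \<in> {0..1}"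
    then show "dist ((\<psi> \<circ> \<alpha>) s) ((\<psi> \<circ> \<alpha>) t) \<le> M * dist s t"
      using *[of s t] *[of t s] by (cases "s \<le> t") (auto simp: dist_commute)
  qed (use w in simp)
  then show thesis using that frechet_rel_time_change[OF p tc] by blast
qed

lemma connecting_curve_lipschitz_representative:
  assumes g: "\<gamma> \<in> connecting_curves D Dt a b" and len: "curve_length \<gamma> < ennreal M"
  obtains \<phi> where "(1, \<phi>) \<in> \<gamma>" "\<phi> \<in> lipschitz_paths M Dt a b"
proof -
  have \<gamma>: "\<gamma> \<in> curves D" "curve_image \<gamma> \<subseteq> Dt" "starts_at \<gamma> a" "ends_at \<gamma> b"
    using g by (auto simp: connecting_curves_def rectifiable_curves_def)
  obtain p where p: "p \<in> params D" "\<gamma> = frechet_rel D `` {p}"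
    using \<gamma>(1) unfolding curves_def by (auto elim: quotientE)
  have pg: "p \<in> \<gamma>" using p equiv_class_self[OF equiv_frechet_rel] by blast
  obtain T \<psi> where pT: "p = (T, \<psi>)" by (cases p)
  have "param_length (T, \<psi>) < ennreal M" using len curve_length_eq[OF \<gamma>(1) pg] pT by simp
  then obtain \<phi> where \<phi>: "((T, \<psi>), (1, \<phi>)) \<in> frechet_rel D" "M-lipschitz_on {0..1} \<phi>"
    using lipschitz_reparametrization p(1) pT by blast
  then have in\<gamma>: "(1, \<phi>) \<in> \<gamma>" using p pT by auto
  then have "\<phi> \<in> lipschitz_paths M Dt a b"
    using \<phi>(2) \<gamma> curve_image_eq[OF \<gamma>(1) in\<gamma>] curve_ends_iff[OF \<gamma>(1) in\<gamma>]
    by (simp add: lipschitz_paths_def)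
  then show thesis using that in\<gamma> by blast
qed

lemma C_tilde_lipschitz:
  assumes "\<phi> \<in> lipschitz_paths M D a b"
  shows "\<phi> \<in> C_tilde D"
proof -
  have lip: "M-lipschitz_on {0..1} \<phi>" and im: "\<phi> ` {0..1} \<subseteq> D"
    using assms by (auto simp: lipschitz_paths_def)
  have M: "0 \<le> M" using lip by (rule lipschitz_on_nonneg)
  have "abs_continuous_on (I \<inter> {0..1}) \<phi>" for I
    unfolding abs_continuous_on_def
  proof (intro allI impI)
    fix e :: real assume e: "0 < e"
    show "\<exists>\<delta>>0. \<forall>F :: (real \<times> real) set. finite F \<and> (\<forall>(s, t)\<in>F. s \<le> t \<and> {s..t} \<subseteq> I \<inter> {0..1}) \<and>
          disjoint_family_on (\<lambda>(s, t). {s<..<t}) F \<and> (\<Sum>(s, t)\<in>F. t - s) < \<delta>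
        \<longrightarrow> (\<Sum>(s, t)\<in>F. norm (\<phi> t - \<phi> s)) < e"
    proof (intro exI[of _ "e / (M + 1)"] conjI allI impI)
      fix F :: "(real \<times> real) set"
      assume F: "finite F \<and> (\<forall>(s, t)\<in>F. s \<le> t \<and> {s..t} \<subseteq> I \<inter> {0..1}) \<and>
          disjoint_family_on (\<lambda>(s, t). {s<..<t}) F \<and> (\<Sum>(s, t)\<in>F. t - s) < e / (M + 1)"
      have "(\<Sum>(s, t)\<in>F. norm (\<phi> t - \<phi> s)) \<le> (\<Sum>(s, t)\<in>F. M * (t - s))"
      proof (rule sum_mono, clarify)
        fix s t assume "(s, t) \<in> F"
        then have st: "s \<le> t" "{s..t} \<subseteq> {0..1}" using F by auto
        then have "s \<in> {0..1}" "t \<in> {0..1}" by auto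
        then show "norm (\<phi> t - \<phi> s) \<le> M * (t - s)"
          using lipschitz_onD[OF lip, of t s] st by (simp add: dist_norm dist_real_def)
      qed
      also have "\<dots> = M * (\<Sum>(s, t)\<in>F. t - s)" by (simp add: sum_distrib_left case_prod_unfold)
      also have "\<dots> \<le> M * (e / (M + 1))" using F M by (intro mult_left_mono) auto
      also have "\<dots> < e" using M e by (simp add: field_simps)
      finally show "(\<Sum>(s, t)\<in>F. norm (\<phi> t - \<phi> s)) < e" .
    qed (use e M in simp)
  qed
  then show ?thesis
    using im lipschitz_on_continuous_on[OF lip] unfolding C_tilde_def
    by (auto simp del: Int_atLeastAtMost intro!: exI[of _ "{}"] exI[of _ 1])
qed

lemma param_length_lipschitz_le:
  assumes lip: "M-lipschitz_on {0..1} \<phi>"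
  shows "param_length (1, \<phi>) \<le> ennreal M"
proof -
  have M: "0 \<le> M" using lip by (rule lipschitz_on_nonneg)
  have "ennreal (\<Sum>i<m. dist (\<phi> (t i)) (\<phi> (t (Suc i)))) \<le> ennreal M"
    if t: "\<forall>i\<le>m. t i \<in> {0..1}" "\<forall>i<m. t i \<le> t (Suc i)" for m :: nat and t :: "nat \<Rightarrow> real"
  proof (rule ennreal_leI)
    have "(\<Sum>i<m. dist (\<phi> (t i)) (\<phi> (t (Suc i)))) \<le> (\<Sum>i<m. M * (t (Suc i) - t i))"
    proof (rule sum_mono)
      fix i assume i: "i \<in> {..<m}"
      then have "t i \<in> {0..1}" "t (Suc i) \<in> {0..1}" "t i \<le> t (Suc i)" using t by auto
      then show "dist (\<phi> (t i)) (\<phi> (t (Suc i))) \<le> M * (t (Suc i) - t i)"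
        using lipschitz_onD[OF lip, of "t i" "t (Suc i)"] by (simp add: dist_real_def)
    qed
    also have "\<dots> = M * (t m - t 0)" by (simp add: sum_distrib_left[symmetric] sum_lessThan_telescope)
    also have "\<dots> \<le> M * 1" using M t(1)[rule_format, of 0] t(1)[rule_format, of m] by (intro mult_left_mono) auto
    finally show "(\<Sum>i<m. dist (\<phi> (t i)) (\<phi> (t (Suc i)))) \<le> M" by simp
  qed
  then show ?thesis unfolding param_length_def by (auto intro!: SUP_least)
qed

lemma lipschitz_path_curve:
  assumes \<phi>: "\<phi> \<in> lipschitz_paths M Dt a b" and D: "Dt \<subseteq> D"
  obtains \<gamma> where "\<gamma> \<in> connecting_curves D Dt a b" "(1, \<phi>) \<in> \<gamma>"
    "curve_image \<gamma> = \<phi> ` {0..1}" "curve_length \<gamma> \<le> ennreal M"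
proof -
  have lip: "M-lipschitz_on {0..1} \<phi>" and im: "\<phi> ` {0..1} \<subseteq> Dt" and ends: "\<phi> 0 = a" "\<phi> 1 = b"
    using \<phi> by (auto simp: lipschitz_paths_def)
  define \<gamma> where "\<gamma> = frechet_rel D `` {(1, \<phi>)}"
  have p: "(1, \<phi>) \<in> params D"
    using im D lipschitz_on_continuous_on[OF lip] by (auto simp: params_def)
  have c: "\<gamma> \<in> curves D" unfolding \<gamma>_def curves_def using p by (rule quotientI)
  have i: "(1, \<phi>) \<in> \<gamma>" unfolding \<gamma>_def using p equiv_class_self[OF equiv_frechet_rel] by blast
  have len: "curve_length \<gamma> \<le> ennreal M"
    using curve_length_eq[OF c i] param_length_lipschitz_le[OF lip] by simp
  then have "curve_length \<gamma> < \<infinity>" using le_less_trans by fastforce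
  then have "\<gamma> \<in> connecting_curves D Dt a b"
    using c curve_image_eq[OF c i] curve_ends_iff[OF c i] im ends
    by (simp add: connecting_curves_def rectifiable_curves_def)
  then show thesis using that i len curve_image_eq[OF c i] by blast
qed

section \<open>The action as a limit of sums\<close>

text \<open>
  The action of the piecewise linear interpolation of \<open>\<phi>\<close> at the points \<open>i / N\<close>, with the
  position frozen at the left end of each piece.
\<close>

definition action_sum ::
  "('a \<Rightarrow> 'a::real_vector \<Rightarrow> real) \<Rightarrow> nat \<Rightarrow> (real \<Rightarrow> 'a) \<Rightarrow> real" where
  "action_sum l N \<phi> = (\<Sum>i<N. l (\<phi> (i / N)) (\<phi> (Suc i / N) - \<phi> (i / N)))"

lemma floor_grid_LIMSEQ:
  fixes t :: real
  assumes t: "0 \<le> t"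
  shows "(\<lambda>n. real (nat \<lfloor>real (Suc n) * t\<rfloor>) / real (Suc n)) \<longlonglongrightarrow> t"
proof (rule tendsto_sandwich)
  have *: "t - 1 / real (Suc n) \<le> real (nat \<lfloor>real (Suc n) * t\<rfloor>) / real (Suc n)"
    "real (nat \<lfloor>real (Suc n) * t\<rfloor>) / real (Suc n) \<le> t" for n
  proof -
    have "0 \<le> \<lfloor>real (Suc n) * t\<rfloor>" using t by simp
    then have e: "real (nat \<lfloor>real (Suc n) * t\<rfloor>) = of_int \<lfloor>real (Suc n) * t\<rfloor>" by simp
    have fl: "real (Suc n) * t - 1 \<le> of_int \<lfloor>real (Suc n) * t\<rfloor>" "of_int \<lfloor>real (Suc n) * t\<rfloor> \<le> real (Suc n) * t"
      by linarith+
    have "t - 1 / real (Suc n) = (real (Suc n) * t - 1) / real (Suc n)"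
      by (simp add: diff_divide_distrib del: of_nat_Suc)
    also have "\<dots> \<le> real (nat \<lfloor>real (Suc n) * t\<rfloor>) / real (Suc n)"
      unfolding e using fl(1) by (intro divide_right_mono) auto
    finally show "t - 1 / real (Suc n) \<le> real (nat \<lfloor>real (Suc n) * t\<rfloor>) / real (Suc n)" .
    show "real (nat \<lfloor>real (Suc n) * t\<rfloor>) / real (Suc n) \<le> t"
      unfolding e using fl(2) by (simp add: pos_divide_le_eq mult.commute del: of_nat_Suc)
  qed
  show "\<forall>\<^sub>F n in sequentially. t - 1 / real (Suc n) \<le> real (nat \<lfloor>real (Suc n) * t\<rfloor>) / real (Suc n)"
    "\<forall>\<^sub>F n in sequentially. real (nat \<lfloor>real (Suc n) * t\<rfloor>) / real (Suc n) \<le> t"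
    using * by auto
  have "(\<lambda>n. t - 1 / real (Suc n)) \<longlonglongrightarrow> t - 0"
    by (intro tendsto_intros LIMSEQ_Suc[OF lim_1_over_n])
  then show "(\<lambda>n. t - 1 / real (Suc n)) \<longlonglongrightarrow> t" by simp
qed simp

lemma straddling_quotient_LIMSEQ:
  fixes \<phi> :: "real \<Rightarrow> 'a::real_normed_vector"
  assumes d: "(\<phi> has_vector_derivative d) (at u)"
    and ab: "\<And>n. a n \<le> u" "\<And>n. u < b n" and lim: "a \<longlonglongrightarrow> u" "b \<longlonglongrightarrow> u"
  shows "(\<lambda>n. (\<phi> (b n) - \<phi> (a n)) /\<^sub>R (b n - a n)) \<longlonglongrightarrow> d"
proof (rule tendstoI)
  fix e :: real assume e: "0 < e"
  have "(\<phi> has_derivative (\<lambda>x. x *\<^sub>R d)) (at u)" using d by (simp add: has_vector_derivative_def)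
  then have "\<forall>e>0. \<exists>k>0. \<forall>y. norm (y - u) < k \<longrightarrow>
      norm (\<phi> y - \<phi> u - (y - u) *\<^sub>R d) \<le> e * norm (y - u)"
    unfolding has_derivative_at_alt by blast
  then obtain k where k: "k > 0"
    "\<And>y. norm (y - u) < k \<Longrightarrow> norm (\<phi> y - \<phi> u - (y - u) *\<^sub>R d) \<le> e / 2 * norm (y - u)"
    using e half_gt_zero by blast
  have ev: "\<forall>\<^sub>F n in sequentially. dist (a n) u < k" "\<forall>\<^sub>F n in sequentially. dist (b n) u < k"
    using tendstoD[OF lim(1) k(1)] tendstoD[OF lim(2) k(1)] .
  show "\<forall>\<^sub>F n in sequentially. dist ((\<phi> (b n) - \<phi> (a n)) /\<^sub>R (b n - a n)) d < e"
    using ev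
  proof eventually_elim
    case (elim n)
    let ?w = "b n - a n"
    have w: "?w > 0" using ab[of n] by linarith
    have "norm (\<phi> (b n) - \<phi> (a n) - ?w *\<^sub>R d)
        = norm ((\<phi> (b n) - \<phi> u - (b n - u) *\<^sub>R d) - (\<phi> (a n) - \<phi> u - (a n - u) *\<^sub>R d))"
      by (rule arg_cong[where f = norm]) (simp add: algebra_simps)
    also have "\<dots> \<le> norm (\<phi> (b n) - \<phi> u - (b n - u) *\<^sub>R d) + norm (\<phi> (a n) - \<phi> u - (a n - u) *\<^sub>R d)"
      by (rule norm_triangle_ineq4)
    also have "\<dots> \<le> e / 2 * norm (b n - u) + e / 2 * norm (a n - u)"
      using elim by (intro add_mono k(2)) (auto simp: dist_norm)
    also have "\<dots> = e / 2 * (norm (b n - u) + norm (a n - u))" by (simp only: distrib_left)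
    also have "norm (b n - u) + norm (a n - u) = ?w" using ab[of n] by simp
    finally have "norm (\<phi> (b n) - \<phi> (a n) - ?w *\<^sub>R d) \<le> e / 2 * ?w" .
    moreover have "(\<phi> (b n) - \<phi> (a n)) /\<^sub>R ?w - d = (\<phi> (b n) - \<phi> (a n) - ?w *\<^sub>R d) /\<^sub>R ?w"
      using w by (simp add: scaleR_diff_right)
    ultimately have "norm ((\<phi> (b n) - \<phi> (a n)) /\<^sub>R ?w - d) \<le> e / 2"
      using w by (simp add: divide_inverse[symmetric] pos_divide_le_eq mult.commute[of "inverse _"])
    then show ?case using e by (simp add: dist_norm)
  qed
qed

lemma AE_vector_derivative_lipschitz_path:
  fixes \<phi> :: "real \<Rightarrow> 'a::euclidean_space"
  assumes lip: "M-lipschitz_on {0..1} \<phi>"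
  shows "AE u in lborel. u \<in> {0<..<1} \<longrightarrow> (\<exists>d. (\<phi> has_vector_derivative d) (at u))"
proof -
  define \<theta> where "\<theta> = (\<lambda>u. \<phi> (max 0 (min 1 u)))"
  have "M-lipschitz_on UNIV \<theta>"
  proof (rule lipschitz_onI)
    fix s t :: real
    have "dist (\<theta> s) (\<theta> t) \<le> M * dist (max 0 (min 1 s)) (max 0 (min 1 t))"
      unfolding \<theta>_def by (rule lipschitz_onD[OF lip]) auto
    also have "\<dots> \<le> M * dist s t"
      using lipschitz_on_nonneg[OF lip] by (intro mult_left_mono) (auto simp: dist_real_def)
    finally show "dist (\<theta> s) (\<theta> t) \<le> M * dist s t" .
  qed (rule lipschitz_on_nonneg[OF lip])
  from AE_differentiable_lipschitz[OF this] show ?thesis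
  proof (rule eventually_mono)
    fix u assume d: "\<theta> differentiable (at u)"
    show "u \<in> {0<..<1} \<longrightarrow> (\<exists>d. (\<phi> has_vector_derivative d) (at u))"
    proof
      assume u: "u \<in> {0<..<1}"
      have "(\<theta> has_vector_derivative vector_derivative \<theta> (at u)) (at u)"
        using d by (simp add: vector_derivative_works)
      then have "(\<phi> has_vector_derivative vector_derivative \<theta> (at u)) (at u)"
        by (rule has_vector_derivative_transform_within_open[of _ _ _ "{0<..<1}"]) (use u in \<open>auto simp: \<theta>_def\<close>)
      then show "\<exists>d. (\<phi> has_vector_derivative d) (at u)" ..
    qed
  qed
qed

text \<open>
  The integrand is not known to be measurable, as \<open>vector_derivative\<close> is unspecified where \<open>\<phi>\<close> is
  not differentiable. It agrees almost everywhere with the limit \<open>w\<close> of the step functions \<open>f n\<close>,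
  which is Borel, and that determines its integral.
\<close>

lemma action_integral_eq_lim:
  fixes l :: "real ^ 'n \<Rightarrow> real ^ 'n \<Rightarrow> real" and \<phi> :: "real \<Rightarrow> real ^ ('n::finite)"
  assumes l: "local_action D l" and \<phi>: "\<phi> \<in> lipschitz_paths M D a b"
  obtains s where "0 \<le> s" "(\<lambda>n. action_sum l (Suc n) \<phi>) \<longlonglongrightarrow> s"
    "(\<integral>\<^sup>+u\<in>{0..1}. ennreal (l (\<phi> u) (vector_derivative \<phi> (at u within {0..1}))) \<partial>lborel) = ennreal s"
proof -
  have lip: "M-lipschitz_on {0..1} \<phi>" and im: "\<phi> ` {0..1} \<subseteq> D"
    using \<phi> by (auto simp: lipschitz_paths_def)
  have cont: "continuous_on {0..1} \<phi>" using lip by (rule lipschitz_on_continuous_on)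
  have lc: "continuous_on (D \<times> UNIV) (\<lambda>(x, y). l x y)"
    and l0: "\<And>x y. x \<in> D \<Longrightarrow> 0 \<le> l x y"
    and lh: "\<And>x y c. x \<in> D \<Longrightarrow> 0 \<le> c \<Longrightarrow> l x (c *\<^sub>R y) = c * l x y"
    using l by (auto simp: local_action_def)
  have "compact ((\<lambda>(x, y). l x y) ` (\<phi> ` {0..1} \<times> cball 0 M))"
    using im cont by (intro compact_continuous_image continuous_on_subset[OF lc] compact_Times) 
      (auto intro: compact_continuous_image)
  then obtain B where B: "\<And>x y. x \<in> \<phi> ` {0..1} \<Longrightarrow> norm y \<le> M \<Longrightarrow> \<bar>l x y\<bar> \<le> B"
    unfolding compact_eq_bounded_closed bounded_iff by force
  define \<psi> where "\<psi> = (\<lambda>n i. l (\<phi> (real i / real (Suc n)))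
    ((\<phi> (real (Suc i) / real (Suc n)) - \<phi> (real i / real (Suc n))) /\<^sub>R (real (Suc i) / real (Suc n) - real i / real (Suc n))))"
  define f where "f = (\<lambda>n u. \<Sum>i<Suc n. \<psi> n i * indicator {real i / real (Suc n)..<real (Suc i) / real (Suc n)} u)"
  have width: "real (Suc i) / real (Suc n) - real i / real (Suc n) = 1 / real (Suc n)" for i n
    by (simp add: diff_divide_distrib[symmetric])
  have grid: "real i / real (Suc n) \<in> {0..1}" if "i \<le> Suc n" for i n
    using that by (simp add: divide_le_eq_1 del: of_nat_Suc)
  have grid': "real (Suc i) / real (Suc n) \<in> {0..1}" if "i \<le> n" for i n
    using that by (intro grid) simp
  have f_m: "f n \<in> borel_measurable lborel" for n unfolding f_def by measurable
  have f_int: "integral\<^sup>L lborel (f n) = action_sum l (Suc n) \<phi>" for n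
  proof -
    have "integral\<^sup>L lborel (f n)
        = (\<Sum>i<Suc n. \<psi> n i * (real (Suc i) / real (Suc n) - real i / real (Suc n)))"
      unfolding f_def
      by (subst Bochner_Integration.integral_sum) (auto simp: divide_right_mono simp del: of_nat_Suc)
    also have "\<dots> = action_sum l (Suc n) \<phi>"
      unfolding action_sum_def
    proof (rule sum.cong[OF refl])
      fix i assume i: "i \<in> {..<Suc n}"
      have "\<phi> (real i / real (Suc n)) \<in> D" using im grid[of i n] i by auto
      then show "\<psi> n i * (real (Suc i) / real (Suc n) - real i / real (Suc n))
        = l (\<phi> (real i / real (Suc n))) (\<phi> (real (Suc i) / real (Suc n)) - \<phi> (real i / real (Suc n)))"
        unfolding \<psi>_def width by (subst lh) (auto simp del: of_nat_Suc)
    qed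
    finally show ?thesis .
  qed
  have f_eq: "f n u = \<psi> n (nat \<lfloor>real (Suc n) * u\<rfloor>) \<and> nat \<lfloor>real (Suc n) * u\<rfloor> \<le> n \<and>
      real (nat \<lfloor>real (Suc n) * u\<rfloor>) / real (Suc n) \<le> u \<and> u < real (Suc (nat \<lfloor>real (Suc n) * u\<rfloor>)) / real (Suc n)"
    if u: "u \<in> {0..<1}" for u n
  proof -
    define j where "j = nat \<lfloor>real (Suc n) * u\<rfloor>"
    have "0 \<le> \<lfloor>real (Suc n) * u\<rfloor>" using u by simp
    then have "real j = of_int \<lfloor>real (Suc n) * u\<rfloor>" by (simp add: j_def)
    then have j: "real j \<le> real (Suc n) * u" "real (Suc n) * u < real (Suc j)" by linarith+
    have iff: "u \<in> {real i / real (Suc n)..<real (Suc i) / real (Suc n)} \<longleftrightarrow> i = j" for i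
    proof -
      have "u \<in> {real i / real (Suc n)..<real (Suc i) / real (Suc n)} \<longleftrightarrow>
          real i \<le> real (Suc n) * u \<and> real (Suc n) * u < real (Suc i)"
        by (simp add: pos_divide_le_eq pos_less_divide_eq mult.commute del: of_nat_Suc)
      also have "\<dots> \<longleftrightarrow> i = j"
      proof
        assume *: "real i \<le> real (Suc n) * u \<and> real (Suc n) * u < real (Suc i)"
        then have "real i < real (Suc j)" "real j < real (Suc i)" using j by linarith+
        then show "i = j" by simp
      qed (use j in simp)
      finally show ?thesis .
    qed
    have jn: "j \<le> n"
    proof -
      have "real (Suc n) * u < real (Suc n) * 1" using u by (intro mult_strict_left_mono) auto
      from order.strict_trans1[OF j(1) this] have "real j < real (Suc n)"
        by (simp only: mult_1_right)
      then show ?thesis by simp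
    qed
    have "f n u = (\<Sum>i<Suc n. if i = j then \<psi> n i else 0)"
      unfolding f_def by (intro sum.cong refl) (auto simp only: indicator_def iff of_bool_def mult_1_right mult_zero_right split: if_splits)
    also have "\<dots> = \<psi> n j" using jn by (simp del: sum.lessThan_Suc)
    finally show ?thesis using jn iff[of j] unfolding j_def[symmetric] by auto
  qed
  have f_out: "f n u = 0" if u: "u \<notin> {0..<1}" for u n
    unfolding f_def
  proof (rule sum.neutral, rule ballI)
    fix i assume "i \<in> {..<Suc n}"
    then have "{real i / real (Suc n)..<real (Suc i) / real (Suc n)} \<subseteq> {0..<1}"
      using grid[of i n] grid'[of i n] by auto
    then have "u \<notin> {real i / real (Suc n)..<real (Suc i) / real (Suc n)}" using u by blast
    then show "\<psi> n i * indicator {real i / real (Suc n)..<real (Suc i) / real (Suc n)} u = 0"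
      unfolding indicator_def by (simp del: atLeastLessThan_iff of_nat_Suc)
  qed
  have \<psi>_bd: "\<bar>\<psi> n i\<bar> \<le> B \<and> 0 \<le> \<psi> n i" if i: "i \<le> n" for n i
  proof -
    have g: "real i / real (Suc n) \<in> {0..1}" "real (Suc i) / real (Suc n) \<in> {0..1}"
      using grid[of i n] grid'[of i n] i by auto
    have "dist (\<phi> (real (Suc i) / real (Suc n))) (\<phi> (real i / real (Suc n))) \<le> M * (1 / real (Suc n))"
      using lipschitz_onD[OF lip g(2,1)] width[of i n] by (simp add: dist_real_def del: of_nat_Suc)
    then have "norm ((\<phi> (real (Suc i) / real (Suc n)) - \<phi> (real i / real (Suc n))) /\<^sub>R (1 / real (Suc n))) \<le> M"
      by (simp add: dist_norm pos_le_divide_eq mult.commute del: of_nat_Suc)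
    then show ?thesis using B g l0 im unfolding \<psi>_def width by blast
  qed
  have f_bd: "norm (f n u) \<le> B * indicator {0..1} u" and f_nn: "0 \<le> f n u" for n u
  proof -
    show "norm (f n u) \<le> B * indicator {0..1} u"
      using f_eq[of u n] f_out[of u n] \<psi>_bd[of "nat \<lfloor>real (Suc n) * u\<rfloor>" n] \<psi>_bd[of 0 n]
      by (cases "u \<in> {0..<1}") (auto simp: indicator_def)
    show "0 \<le> f n u"
      using f_eq[of u n] f_out[of u n] \<psi>_bd[of "nat \<lfloor>real (Suc n) * u\<rfloor>" n]
      by (cases "u \<in> {0..<1}") auto
  qed
  let ?d = "\<lambda>u. vector_derivative \<phi> (at u within {0..1})"
  have f_lim: "(\<lambda>n. f n u) \<longlonglongrightarrow> l (\<phi> u) (?d u)"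
    if u: "u \<in> {0<..<1}" and d: "(\<phi> has_vector_derivative d) (at u)" for u d
  proof -
    define j where "j = (\<lambda>n. nat \<lfloor>real (Suc n) * u\<rfloor>)"
    let ?a = "\<lambda>n. real (j n) / real (Suc n)" and ?b = "\<lambda>n. real (Suc (j n)) / real (Suc n)"
    have j: "f n u = \<psi> n (j n)" "j n \<le> n" "?a n \<le> u" "u < ?b n" for n
      using f_eq[of u n] u by (auto simp: j_def)
    have a: "?a \<longlonglongrightarrow> u" unfolding j_def using u by (intro floor_grid_LIMSEQ) auto
    have b: "?b \<longlonglongrightarrow> u"
    proof -
      have "(\<lambda>n. ?a n + 1 / real (Suc n)) \<longlonglongrightarrow> u + 0"
        by (intro tendsto_add a LIMSEQ_Suc[OF lim_1_over_n])
      moreover have "?a n + 1 / real (Suc n) = ?b n" for n using width[of "j n" n] by linarith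
      ultimately show ?thesis by simp
    qed
    have q: "(\<lambda>n. (\<phi> (?b n) - \<phi> (?a n)) /\<^sub>R (?b n - ?a n)) \<longlonglongrightarrow> d"
      by (rule straddling_quotient_LIMSEQ[OF d]) (use j a b in auto)
    have "isCont \<phi> u" using d has_vector_derivative_continuous by blast
    then have p: "(\<lambda>n. \<phi> (?a n)) \<longlonglongrightarrow> \<phi> u" using a by (rule isCont_tendsto_compose)
    have "(\<lambda>n. (\<lambda>(x, y). l x y) (\<phi> (?a n), (\<phi> (?b n) - \<phi> (?a n)) /\<^sub>R (?b n - ?a n))) \<longlonglongrightarrow> (\<lambda>(x, y). l x y) (\<phi> u, d)"
    proof (rule continuous_on_tendsto_compose[OF lc tendsto_Pair[OF p q]])
      show "(\<phi> u, d) \<in> D \<times> UNIV" using im u by auto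
      have "\<phi> (?a n) \<in> D" for n using im grid[of "j n" n] j(2)[of n] by auto
      then show "\<forall>\<^sub>F n in sequentially. (\<phi> (?a n), (\<phi> (?b n) - \<phi> (?a n)) /\<^sub>R (?b n - ?a n)) \<in> D \<times> UNIV"
        by simp
    qed
    then have "(\<lambda>n. f n u) \<longlonglongrightarrow> l (\<phi> u) d" by (simp add: j(1) \<psi>_def)
    moreover have "?d u = d" using d u by (intro vector_derivative_at_within_ivl) auto
    ultimately show ?thesis by simp
  qed
  define w where "w = (\<lambda>u. lim (\<lambda>n. f n u))"
  have w_m: "w \<in> borel_measurable lborel" unfolding w_def using f_m by (rule borel_measurable_lim_metric)
  have AEd: "AE u in lborel. (\<lambda>n. f n u) \<longlonglongrightarrow> w u \<and>
      ennreal (l (\<phi> u) (?d u)) * indicator {0..1} u = ennreal (w u)"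
    using AE_vector_derivative_lipschitz_path[OF lip] AE_lborel_singleton[of "0::real"] AE_lborel_singleton[of "1::real"]
  proof eventually_elim
    case (elim u)
    show ?case
    proof (cases "u \<in> {0<..<1}")
      case True
      then have "(\<lambda>n. f n u) \<longlonglongrightarrow> l (\<phi> u) (?d u)" using elim f_lim by blast
      moreover from this have "w u = l (\<phi> u) (?d u)" unfolding w_def by (rule limI)
      ultimately show ?thesis using True by simp
    next
      case False
      then have u: "u \<notin> {0..<1}" "u \<notin> {0..1}" using elim by auto
      then have "(\<lambda>n. f n u) \<longlonglongrightarrow> 0" using f_out[of u] by simp
      moreover from this have "w u = 0" unfolding w_def by (rule limI)
      ultimately show ?thesis using u by simp
    qed
  qed
  have bi: "integrable lborel (\<lambda>u::real. B * indicator {0..1} u)" by simp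
  have lims: "AE u in lborel. (\<lambda>n. f n u) \<longlonglongrightarrow> w u" using AEd by eventually_elim simp
  have bds: "AE u in lborel. norm (f n u) \<le> B * indicator {0..1} u" for n using f_bd by simp
  have w_int: "integrable lborel w" by (rule integrable_dominated_convergence[OF w_m f_m bi lims bds])
  have "(\<lambda>n. integral\<^sup>L lborel (f n)) \<longlonglongrightarrow> integral\<^sup>L lborel w"
    by (rule integral_dominated_convergence[OF w_m f_m bi lims bds])
  then have 1: "(\<lambda>n. action_sum l (Suc n) \<phi>) \<longlonglongrightarrow> integral\<^sup>L lborel w" by (simp add: f_int)
  have w_nn: "AE u in lborel. 0 \<le> w u"
    using lims by eventually_elim (rule LIMSEQ_le_const, use f_nn in auto)
  have "(\<integral>\<^sup>+u\<in>{0..1}. ennreal (l (\<phi> u) (?d u)) \<partial>lborel) = (\<integral>\<^sup>+u. ennreal (w u) \<partial>lborel)"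
    by (rule nn_integral_cong_AE) (use AEd in \<open>eventually_elim, simp\<close>)
  also have "\<dots> = ennreal (integral\<^sup>L lborel w)" using w_int w_nn by (rule nn_integral_eq_integral)
  finally show thesis using that 1 integral_nonneg_AE[OF w_nn] by blast
qed

lemma geometric_action_eq_lim:
  assumes S: "geometric_action D l S" and \<gamma>: "\<gamma> \<in> curves D" "(1, \<phi>) \<in> \<gamma>"
    and \<phi>: "\<phi> \<in> lipschitz_paths M D a b"
  obtains s where "0 \<le> s" "S \<gamma> = ennreal s" "(\<lambda>n. action_sum l (Suc n) \<phi>) \<longlonglongrightarrow> s"
proof -
  have l: "local_action D l" using S by (simp add: geometric_action_def)
  have c: "\<phi> \<in> C_tilde D" using C_tilde_lipschitz[OF \<phi>] .
  then have "\<gamma> \<in> Gamma_tilde D" using \<gamma> by (auto simp: Gamma_tilde_def)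
  then have "S \<gamma> = (\<integral>\<^sup>+u\<in>{0..1}. ennreal (l (\<phi> u) (vector_derivative \<phi> (at u within {0..1}))) \<partial>lborel)"
    using S c \<gamma>(2) by (simp add: geometric_action_def)
  then show thesis using action_integral_eq_lim[OF l \<phi>] that by metis
qed

section \<open>Lower semicontinuity and bounds\<close>

text \<open>Uniform continuity on \<open>K \<times> sphere 0 1\<close>, extended to all directions by homogeneity.\<close>

lemma local_action_modulus:
  fixes l :: "real ^ 'n \<Rightarrow> real ^ 'n \<Rightarrow> real"
  assumes l: "local_action D l" and K: "compact K" "K \<subseteq> D" and e: "0 < e"
  obtains \<delta> where "0 < \<delta>"
    "\<And>z z' y. \<lbrakk>z \<in> K; z' \<in> K; dist z z' < \<delta>\<rbrakk> \<Longrightarrow> \<bar>l z y - l z' y\<bar> \<le> e * norm y"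
proof -
  have lc: "continuous_on (D \<times> UNIV) (\<lambda>(x, y). l x y)"
    and lh: "\<And>x y c. x \<in> D \<Longrightarrow> 0 \<le> c \<Longrightarrow> l x (c *\<^sub>R y) = c * l x y"
    using l by (auto simp: local_action_def)
  have "uniformly_continuous_on (K \<times> sphere 0 1) (\<lambda>(x, y). l x y)"
    using K by (intro compact_uniformly_continuous continuous_on_subset[OF lc] compact_Times) auto
  then obtain \<delta> where \<delta>: "0 < \<delta>"
    "\<And>p q. \<lbrakk>p \<in> K \<times> sphere 0 1; q \<in> K \<times> sphere 0 1; dist q p < \<delta>\<rbrakk>
      \<Longrightarrow> dist ((\<lambda>(x, y). l x y) q) ((\<lambda>(x, y). l x y) p) < e"
    using e unfolding uniformly_continuous_on_def by metis
  show thesis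
  proof (rule that[OF \<delta>(1)])
    fix z z' y :: "real ^ 'n" assume z: "z \<in> K" "z' \<in> K" "dist z z' < \<delta>"
    define v where "v = y /\<^sub>R norm y"
    have y: "y = norm y *\<^sub>R v" by (cases "y = 0") (auto simp: v_def)
    have D: "z \<in> D" "z' \<in> D" using z K by auto
    show "\<bar>l z y - l z' y\<bar> \<le> e * norm y"
    proof (cases "y = 0")
      case True
      then show ?thesis using lh[OF D(1), of 0 0] lh[OF D(2), of 0 0] by simp
    next
      case False
      then have "norm v = 1" by (simp add: v_def)
      then have "\<bar>l z v - l z' v\<bar> \<le> e"
        using \<delta>(2)[of "(z', v)" "(z, v)"] z by (auto simp: dist_Pair_Pair dist_real_def)
      then have "norm y * \<bar>l z v - l z' v\<bar> \<le> norm y * e" by (intro mult_left_mono) auto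
      moreover have "l z y - l z' y = norm y * (l z v - l z' v)"
        using lh[OF D(1), of "norm y" v] lh[OF D(2), of "norm y" v] y by (simp add: right_diff_distrib)
      ultimately show ?thesis by (simp add: abs_mult mult.commute)
    qed
  qed
qed

lemma local_action_sum_le:
  fixes l :: "real ^ 'n \<Rightarrow> real ^ 'n \<Rightarrow> real" and y :: "nat \<Rightarrow> real ^ 'n"
  assumes l: "local_action D l" and z: "z \<in> D"
  shows "l z (\<Sum>j<k. y j) \<le> (\<Sum>j<k. l z (y j))"
proof (induction k)
  case 0
  have "l z (0 *\<^sub>R 0) = 0 * l z 0" using l z unfolding local_action_def by blast
  then show ?case by simp
next
  case (Suc k)
  let ?a = "\<Sum>j<k. y j"
  have cv: "convex_on UNIV (l z)" and lh: "\<And>y c. 0 \<le> c \<Longrightarrow> l z (c *\<^sub>R y) = c * l z y"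
    using l z by (auto simp: local_action_def)
  have "l z (?a + y k) = 2 * l z ((1/2) *\<^sub>R ?a + (1/2) *\<^sub>R y k)"
    using lh[of 2 "(1/2) *\<^sub>R ?a + (1/2) *\<^sub>R y k"] by (simp add: scaleR_add_right)
  also have "l z ((1/2) *\<^sub>R ?a + (1/2) *\<^sub>R y k) \<le> (1/2) * l z ?a + (1/2) * l z (y k)"
    using convex_onD[OF cv, of "1/2" ?a "y k"] by simp
  finally show ?case using Suc by simp
qed

text \<open>
  In each block of \<open>k\<close> pieces, subadditivity is applied with the position frozen at the start of the
  block. Moving the position to the start of each piece costs at most \<open>e * M\<close> in total.
\<close>

lemma action_sum_refine:
  fixes l :: "real ^ 'n \<Rightarrow> real ^ 'n \<Rightarrow> real"
  assumes l: "local_action D l" and K: "K \<subseteq> D" and \<phi>: "\<phi> \<in> lipschitz_paths M K a b"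
    and mod: "\<And>z z' y. \<lbrakk>z \<in> K; z' \<in> K; dist z z' < \<delta>\<rbrakk> \<Longrightarrow> \<bar>l z y - l z' y\<bar> \<le> e * norm y"
    and e: "0 \<le> e" and N: "0 < N" "M < \<delta> * N" and k: "0 < k"
  shows "action_sum l N \<phi> \<le> action_sum l (N * k) \<phi> + e * M"
proof -
  have lip: "M-lipschitz_on {0..1} \<phi>" and im: "\<phi> ` {0..1} \<subseteq> K"
    using \<phi> by (auto simp: lipschitz_paths_def)
  have M: "0 \<le> M" using lip by (rule lipschitz_on_nonneg)
  let ?t = "\<lambda>j. real j / real (N * k)"
  define \<Delta> where "\<Delta> = (\<lambda>j. \<phi> (?t (Suc j)) - \<phi> (?t j))"
  have Nk: "0 < real (N * k)" using N k by simp
  have t01: "?t j \<in> {0..1}" if "j \<le> N * k" for j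
    using that Nk by (simp add: divide_le_eq_1 del: of_nat_mult)
  have \<Delta>: "norm (\<Delta> j) \<le> M / real (N * k)" if "j < N * k" for j
  proof -
    have "dist (\<phi> (?t (Suc j))) (\<phi> (?t j)) \<le> M * dist (?t (Suc j)) (?t j)"
      using that by (intro lipschitz_onD[OF lip] t01) auto
    also have "dist (?t (Suc j)) (?t j) = 1 / real (N * k)"
      using Nk by (simp add: dist_real_def diff_divide_distrib[symmetric] del: of_nat_mult)
    finally show ?thesis by (simp add: \<Delta>_def dist_norm)
  qed
  have block: "l (\<phi> (real i / real N)) (\<phi> (real (Suc i) / real N) - \<phi> (real i / real N))
      \<le> (\<Sum>j\<in>{i*k..<i*k+k}. l (\<phi> (?t j)) (\<Delta> j) + e * (M / real (N * k)))" if i: "i < N" for i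
  proof -
    have ti: "?t (i * k) = real i / real N" "?t (i * k + k) = real (Suc i) / real N"
      using k N by (auto simp: field_simps)
    have le: "Suc i * k \<le> N * k" using i by (intro mult_le_mono1) simp
    have ik: "i * k \<le> N * k" using i by simp
    have zK: "\<phi> (?t (i * k)) \<in> K" using im t01[OF ik] by auto
    have "(\<Sum>j<k. \<Delta> (i * k + j)) = \<phi> (?t (i * k + k)) - \<phi> (?t (i * k))"
      unfolding \<Delta>_def using sum_lessThan_telescope[of "\<lambda>j. \<phi> (?t (i * k + j))" k] by simp
    then have "l (\<phi> (real i / real N)) (\<phi> (real (Suc i) / real N) - \<phi> (real i / real N))
        = l (\<phi> (?t (i * k))) (\<Sum>j<k. \<Delta> (i * k + j))" by (simp only: ti)
    also have "\<dots> \<le> (\<Sum>j<k. l (\<phi> (?t (i * k))) (\<Delta> (i * k + j)))"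
      using local_action_sum_le[OF l] zK K by blast
    also have "\<dots> \<le> (\<Sum>j<k. l (\<phi> (?t (i * k + j))) (\<Delta> (i * k + j)) + e * (M / real (N * k)))"
    proof (rule sum_mono)
      fix j assume j: "j \<in> {..<k}"
      have jN: "i * k + j < N * k" using le j by auto
      have tt: "?t (i * k + j) \<in> {0..1}" "?t (i * k) \<in> {0..1}" 
        by (rule t01[OF less_imp_le[OF jN]], rule t01[OF ik])
      have "dist (?t (i * k)) (?t (i * k + j)) = real j / real (N * k)"
        using Nk by (simp add: dist_real_def diff_divide_distrib[symmetric] add_divide_distrib del: of_nat_mult)
      also have "\<dots> \<le> real k / real (N * k)" using j by (intro divide_right_mono) auto
      also have "\<dots> = 1 / N" using k by simp
      finally have "M * dist (?t (i * k)) (?t (i * k + j)) \<le> M * (1 / N)" using M by (rule mult_left_mono)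
      also have "\<dots> < \<delta>" using N by (simp add: pos_divide_less_eq)
      finally have "dist (\<phi> (?t (i * k))) (\<phi> (?t (i * k + j))) < \<delta>"
        using lipschitz_onD[OF lip tt(2,1)] by linarith
      then have "\<bar>l (\<phi> (?t (i * k))) (\<Delta> (i * k + j)) - l (\<phi> (?t (i * k + j))) (\<Delta> (i * k + j))\<bar> \<le> e * norm (\<Delta> (i * k + j))"
        using im tt by (intro mod) auto
      also have "\<dots> \<le> e * (M / real (N * k))" using e \<Delta>[OF jN] by (intro mult_left_mono) auto
      finally show "l (\<phi> (?t (i * k))) (\<Delta> (i * k + j)) \<le> l (\<phi> (?t (i * k + j))) (\<Delta> (i * k + j)) + e * (M / real (N * k))"
        by linarith
    qed
    also have "\<dots> = (\<Sum>j\<in>{i*k..<i*k+k}. l (\<phi> (?t j)) (\<Delta> j) + e * (M / real (N * k)))"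
      using sum.shift_bounds_nat_ivl[of "\<lambda>j. l (\<phi> (?t j)) (\<Delta> j) + e * (M / real (N * k))" 0 "i * k" k]
      by (simp add: atLeast0LessThan add.commute)
    finally show ?thesis .
  qed
  have "action_sum l N \<phi> \<le> (\<Sum>i<N. \<Sum>j\<in>{i*k..<i*k+k}. l (\<phi> (?t j)) (\<Delta> j) + e * (M / real (N * k)))"
    unfolding action_sum_def by (intro sum_mono block) simp
  also have "\<dots> = (\<Sum>j<N * k. l (\<phi> (?t j)) (\<Delta> j) + e * (M / real (N * k)))"
    by (rule sum.nat_group)
  also have "\<dots> = action_sum l (N * k) \<phi> + e * M"
  proof -
    have "real (N * k) * (e * (M / real (N * k))) = e * M" using Nk by (simp del: of_nat_mult)
    then show ?thesis by (simp add: sum.distrib action_sum_def \<Delta>_def del: of_nat_mult)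
  qed
  finally show ?thesis .
qed

lemma action_sum_le_limit:
  fixes l :: "real ^ 'n \<Rightarrow> real ^ 'n \<Rightarrow> real"
  assumes l: "local_action D l" and K: "compact K" "K \<subseteq> D" and e: "0 < e" and M: "0 \<le> M"
  obtains n0 where "\<And>n \<phi> a b s. \<lbrakk>n0 \<le> n; \<phi> \<in> lipschitz_paths M K a b;
    (\<lambda>n. action_sum l (Suc n) \<phi>) \<longlonglongrightarrow> s\<rbrakk> \<Longrightarrow> action_sum l (Suc n) \<phi> \<le> s + e"
proof -
  have e': "0 < e / (M + 1)" using e M by simp
  obtain \<delta> where \<delta>: "0 < \<delta>"
    "\<And>z z' y. \<lbrakk>z \<in> K; z' \<in> K; dist z z' < \<delta>\<rbrakk> \<Longrightarrow> \<bar>l z y - l z' y\<bar> \<le> e / (M + 1) * norm y"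
    using local_action_modulus[OF l K e'] by blast
  obtain n0 where n0: "M / \<delta> < real n0" using reals_Archimedean2 by blast
  show thesis
  proof (rule that[of n0])
    fix n \<phi> a b s
    assume n: "n0 \<le> n" and \<phi>: "\<phi> \<in> lipschitz_paths M K a b"
      and s: "(\<lambda>n. action_sum l (Suc n) \<phi>) \<longlonglongrightarrow> s"
    have "M < \<delta> * n0" using n0 \<delta>(1) by (simp add: pos_divide_less_eq mult.commute)
    also have "\<dots> \<le> \<delta> * real (Suc n)" using n \<delta>(1) by (intro mult_left_mono) auto
    finally have Mn: "M < \<delta> * real (Suc n)" .
    have ref: "action_sum l (Suc n) \<phi> - e \<le> action_sum l (Suc n * Suc k) \<phi>" for k
    proof -
      have "e / (M + 1) * M \<le> e" using e M by (simp add: field_simps)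
      then show ?thesis
        using action_sum_refine[OF l K(2) \<phi> \<delta>(2) _ _ Mn, of "Suc k"] e' by simp
    qed
    \<comment> \<open>the refinements of the partition into \<open>Suc n\<close> pieces form a subsequence\<close>
    have sm: "strict_mono (\<lambda>k. Suc n * Suc k - 1)"
      by (rule strict_monoI_Suc) simp
    have "(\<lambda>k. action_sum l (Suc n * Suc k) \<phi>) \<longlonglongrightarrow> s"
      using LIMSEQ_subseq_LIMSEQ[OF s sm] by (simp add: o_def del: mult_Suc mult_Suc_right)
    then have "action_sum l (Suc n) \<phi> - e \<le> s"
      by (rule LIMSEQ_le_const) (use ref in blast)
    then show "action_sum l (Suc n) \<phi> \<le> s + e" by simp
  qed
qed

lemma action_limit_lower_semicontinuous:
  fixes l :: "real ^ 'n \<Rightarrow> real ^ 'n \<Rightarrow> real"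
  assumes l: "local_action D l" and K: "compact K" "K \<subseteq> D"
    and \<phi>k: "\<And>k. \<phi>k k \<in> lipschitz_paths M K (a k) (b k)" and \<phi>: "\<phi> \<in> lipschitz_paths M K a' b'"
    and conv: "\<And>t. t \<in> {0..1} \<Longrightarrow> (\<lambda>k. \<phi>k k t) \<longlonglongrightarrow> \<phi> t"
    and sk: "\<And>k. (\<lambda>n. action_sum l (Suc n) (\<phi>k k)) \<longlonglongrightarrow> s k"
    and s: "(\<lambda>n. action_sum l (Suc n) \<phi>) \<longlonglongrightarrow> s'" and I: "s \<longlonglongrightarrow> I"
  shows "s' \<le> I"
proof (rule field_le_epsilon)
  fix e :: real assume e: "0 < e"
  have lc: "continuous_on (D \<times> UNIV) (\<lambda>(x, y). l x y)"
    using l by (auto simp: local_action_def)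
  have M: "0 \<le> M" using \<phi> by (auto simp: lipschitz_paths_def dest: lipschitz_on_nonneg)
  obtain n0 where n0: "\<And>n \<phi> a b s. \<lbrakk>n0 \<le> n; \<phi> \<in> lipschitz_paths M K a b;
    (\<lambda>n. action_sum l (Suc n) \<phi>) \<longlonglongrightarrow> s\<rbrakk> \<Longrightarrow> action_sum l (Suc n) \<phi> \<le> s + e"
    using action_sum_le_limit[OF l K e M] by blast
  have "action_sum l (Suc n) \<phi> \<le> I + e" if n: "n0 \<le> n" for n
  proof (rule LIMSEQ_le)
    show "(\<lambda>k. action_sum l (Suc n) (\<phi>k k)) \<longlonglongrightarrow> action_sum l (Suc n) \<phi>"
      unfolding action_sum_def
    proof (rule tendsto_sum)
      fix i assume i: "i \<in> {..<Suc n}"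
      have t: "real i / real (Suc n) \<in> {0..1}" "real (Suc i) / real (Suc n) \<in> {0..1}"
        using i by (auto simp: divide_le_eq_1 simp del: of_nat_Suc)
      have inD: "\<phi>k k (real i / real (Suc n)) \<in> D" "\<phi> (real i / real (Suc n)) \<in> D" for k
        using \<phi>k[of k] \<phi> t(1) K(2) unfolding lipschitz_paths_def by blast+
      have "(\<lambda>k. (\<lambda>(x, y). l x y) (\<phi>k k (real i / real (Suc n)),
          \<phi>k k (real (Suc i) / real (Suc n)) - \<phi>k k (real i / real (Suc n))))
        \<longlonglongrightarrow> (\<lambda>(x, y). l x y) (\<phi> (real i / real (Suc n)),
          \<phi> (real (Suc i) / real (Suc n)) - \<phi> (real i / real (Suc n)))"
        by (rule continuous_on_tendsto_compose[OF lc])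
          (intro tendsto_Pair tendsto_diff conv t, use inD in auto)
      then show "(\<lambda>k. l (\<phi>k k (real i / real (Suc n)))
          (\<phi>k k (real (Suc i) / real (Suc n)) - \<phi>k k (real i / real (Suc n))))
        \<longlonglongrightarrow> l (\<phi> (real i / real (Suc n)))
          (\<phi> (real (Suc i) / real (Suc n)) - \<phi> (real i / real (Suc n)))" by simp
    qed
    show "(\<lambda>k. s k + e) \<longlonglongrightarrow> I + e" by (intro tendsto_intros I)
    show "\<exists>N. \<forall>k\<ge>N. action_sum l (Suc n) (\<phi>k k) \<le> s k + e"
      using n0[OF n \<phi>k sk] by blast
  qed
  then show "s' \<le> I + e" using LIMSEQ_le_const2[OF s] by blast
qed

lemma action_limit_upper_bound:
  fixes l :: "'a \<Rightarrow> 'a::real_normed_vector \<Rightarrow> real"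
  assumes lip: "M-lipschitz_on {0..1} \<phi>" and im: "\<phi> ` {0..1} \<subseteq> K"
    and C: "\<And>z y. z \<in> K \<Longrightarrow> l z y \<le> C * norm y" "0 \<le> C"
    and s: "(\<lambda>n. action_sum l (Suc n) \<phi>) \<longlonglongrightarrow> s"
  shows "s \<le> C * M"
proof -
  have "action_sum l (Suc n) \<phi> \<le> C * M" for n
  proof -
    have "action_sum l (Suc n) \<phi> \<le> (\<Sum>i<Suc n. C * (M / real (Suc n)))"
      unfolding action_sum_def
    proof (rule sum_mono)
      fix i assume i: "i \<in> {..<Suc n}"
      have t: "real i / real (Suc n) \<in> {0..1}" "real (Suc i) / real (Suc n) \<in> {0..1}"
        using i by (auto simp: divide_le_eq_1 simp del: of_nat_Suc)
      have "norm (\<phi> (real (Suc i) / real (Suc n)) - \<phi> (real i / real (Suc n))) \<le> M / real (Suc n)"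
      proof -
        have "dist (real (Suc i) / real (Suc n)) (real i / real (Suc n)) = 1 / real (Suc n)"
          by (simp add: dist_real_def diff_divide_distrib[symmetric])
        then show ?thesis using lipschitz_onD[OF lip t(2,1)] by (simp add: dist_norm)
      qed
      then have "C * norm (\<phi> (real (Suc i) / real (Suc n)) - \<phi> (real i / real (Suc n))) \<le> C * (M / real (Suc n))"
        using C(2) by (rule mult_left_mono)
      moreover have "\<phi> (real i / real (Suc n)) \<in> K" using im t by auto
      ultimately show "l (\<phi> (real i / real (Suc n))) (\<phi> (real (Suc i) / real (Suc n)) - \<phi> (real i / real (Suc n)))
          \<le> C * (M / real (Suc n))" using C(1) order_trans by blast
    qed
    also have "\<dots> = C * M" by (simp del: sum.lessThan_Suc of_nat_Suc)
    finally show ?thesis .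
  qed
  then show ?thesis using LIMSEQ_le_const2[OF s] by blast
qed

lemma dist_le_sum_increments:
  fixes f :: "nat \<Rightarrow> 'a::metric_space"
  assumes "a \<le> b"
  shows "dist (f a) (f b) \<le> (\<Sum>j\<in>{a..<b}. dist (f j) (f (Suc j)))"
  using assms
proof (induction b rule: dec_induct)
  case (step n)
  have "dist (f a) (f (Suc n)) \<le> dist (f a) (f n) + dist (f n) (f (Suc n))" by (rule dist_triangle)
  then show ?case using step by simp
qed simp

text \<open>
  Only the increments before the first grid point outside \<open>cball x \<rho>\<close> are estimated with the
  constant \<open>c\<close>; for the others \<open>l \<ge> 0\<close> suffices.
\<close>

lemma action_limit_escape:
  fixes l :: "'a \<Rightarrow> 'a::real_normed_vector \<Rightarrow> real"
  assumes cont: "continuous_on {0..1} \<phi>" and im: "\<phi> ` {0..1} \<subseteq> D"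
    and l0: "\<And>z y. z \<in> D \<Longrightarrow> 0 \<le> l z y"
    and c: "\<And>z y. z \<in> cball x \<rho> \<Longrightarrow> c * norm y \<le> l z y" "0 \<le> c"
    and start: "\<phi> 0 \<in> cball x r" and exit: "t \<in> {0..1}" "\<phi> t \<notin> cball x \<rho>"
    and s: "(\<lambda>n. action_sum l (Suc n) \<phi>) \<longlonglongrightarrow> s"
  shows "c * (\<rho> - r) \<le> s"
proof -
  define j where "j = (\<lambda>n. nat \<lfloor>real (Suc n) * t\<rfloor>)"
  have jn: "j n \<le> Suc n" for n
  proof -
    have "real (Suc n) * t \<le> real (Suc n)" using exit(1) by (intro mult_left_le) auto
    then have "\<lfloor>real (Suc n) * t\<rfloor> \<le> int (Suc n)" by linarith
    then show ?thesis unfolding j_def by linarith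
  qed
  have grid: "real i / real (Suc n) \<in> {0..1}" if "i \<le> Suc n" for i n
    using that by (simp add: divide_le_eq_1 del: of_nat_Suc)
  have "(\<lambda>n. real (j n) / real (Suc n)) \<longlonglongrightarrow> t"
    unfolding j_def using exit by (intro floor_grid_LIMSEQ) auto
  then have "(\<lambda>n. \<phi> (real (j n) / real (Suc n))) \<longlonglongrightarrow> \<phi> t"
    using grid jn exit by (intro continuous_on_tendsto_compose[OF cont]) (auto simp del: of_nat_Suc)
  then have "\<forall>\<^sub>F n in sequentially. \<phi> (real (j n) / real (Suc n)) \<in> - cball x \<rho>"
    using exit by (intro topological_tendstoD) auto
  then have "\<forall>\<^sub>F n in sequentially. c * (\<rho> - r) \<le> action_sum l (Suc n) \<phi>"
  proof eventually_elim
    case (elim n)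
    let ?p = "\<lambda>i. \<phi> (real i / real (Suc n))"
    define k where "k = (LEAST k. ?p k \<notin> cball x \<rho>)"
    have ex: "?p (j n) \<notin> cball x \<rho>" using elim by blast
    have k: "?p k \<notin> cball x \<rho>" unfolding k_def using ex by (rule LeastI)
    have kj: "k \<le> j n" unfolding k_def using ex by (rule Least_le)
    then have kn: "k \<le> Suc n" using jn[of n] by simp
    have lt: "?p i \<in> cball x \<rho>" if "i < k" for i
      using not_less_Least[of i "\<lambda>k. ?p k \<notin> cball x \<rho>"] that unfolding k_def by blast
    have "\<rho> - r \<le> dist (?p 0) (?p k)"
    proof -
      have "dist x (?p k) \<le> dist x (?p 0) + dist (?p 0) (?p k)" by (rule dist_triangle)
      moreover have "dist x (?p 0) \<le> r" using start by simp
      moreover have "\<rho> < dist x (?p k)" using k by (simp del: of_nat_Suc)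
      ultimately show ?thesis by linarith
    qed
    also have "\<dots> \<le> (\<Sum>i<k. dist (?p i) (?p (Suc i)))"
      using dist_le_sum_increments[of 0 k ?p] by (simp add: atLeast0LessThan del: of_nat_Suc)
    finally have "c * (\<rho> - r) \<le> c * (\<Sum>i<k. dist (?p i) (?p (Suc i)))" using c(2) by (rule mult_left_mono)
    also have "\<dots> = (\<Sum>i<k. c * norm (?p (Suc i) - ?p i))"
      by (simp add: sum_distrib_left dist_norm norm_minus_commute del: of_nat_Suc)
    also have "\<dots> \<le> (\<Sum>i<k. l (?p i) (?p (Suc i) - ?p i))"
      by (intro sum_mono c(1) lt) simp
    also have "\<dots> \<le> (\<Sum>i<Suc n. l (?p i) (?p (Suc i) - ?p i))"
    proof (rule sum_mono2)
      fix i assume "i \<in> {..<Suc n} - {..<k}"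
      then have "?p i \<in> D" using grid[of i n] im by (auto simp del: of_nat_Suc)
      then show "0 \<le> l (?p i) (?p (Suc i) - ?p i)" by (rule l0)
    qed (use kn in auto)
    finally show ?case by (simp add: action_sum_def)
  qed
  then show ?thesis using tendsto_lowerbound[OF s] by simp
qed

text \<open>The points of an arbitrary partition are rounded down to grid points.\<close>

lemma param_length_le_action_limit:
  fixes l :: "real ^ 'n \<Rightarrow> real ^ 'n \<Rightarrow> real"
  assumes cont: "continuous_on {0..1} \<phi>" and im: "\<phi> ` {0..1} \<subseteq> K"
    and c: "\<And>z y. z \<in> K \<Longrightarrow> c * norm y \<le> l z y" "0 < c"
    and s: "(\<lambda>n. action_sum l (Suc n) \<phi>) \<longlonglongrightarrow> s"
  shows "param_length (1, \<phi>) \<le> ennreal (s / c)"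
proof -
  have "ennreal (\<Sum>i<m. dist (\<phi> (t i)) (\<phi> (t (Suc i)))) \<le> ennreal (s / c)"
    if t: "\<forall>i\<le>m. t i \<in> {0..1}" "\<forall>i<m. t i \<le> t (Suc i)" for m :: nat and t :: "nat \<Rightarrow> real"
  proof (rule ennreal_leI)
    define d where "d = (\<lambda>n i. nat \<lfloor>real (Suc n) * t i\<rfloor>)"
    have dn: "d n i \<le> Suc n" if "i \<le> m" for n i
    proof -
      have "real (Suc n) * t i \<le> real (Suc n)" using t(1) that by (intro mult_left_le) auto
      then have "\<lfloor>real (Suc n) * t i\<rfloor> \<le> int (Suc n)" by linarith
      then show ?thesis unfolding d_def by linarith
    qed
    have dmono: "d n i \<le> d n (Suc i)" if "i < m" for n i
      unfolding d_def using t that by (intro nat_mono floor_mono mult_left_mono) auto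
    have grid: "real i / real (Suc n) \<in> {0..1}" if "i \<le> Suc n" for i n
      using that by (simp add: divide_le_eq_1 del: of_nat_Suc)
    have lim: "(\<lambda>n. \<phi> (real (d n i) / real (Suc n))) \<longlonglongrightarrow> \<phi> (t i)" if i: "i \<le> m" for i
    proof (rule continuous_on_tendsto_compose[OF cont])
      show "(\<lambda>n. real (d n i) / real (Suc n)) \<longlonglongrightarrow> t i"
        unfolding d_def using t(1) i by (intro floor_grid_LIMSEQ) auto
      show "t i \<in> {0..1}" using t(1) i by blast
      show "\<forall>\<^sub>F n in sequentially. real (d n i) / real (Suc n) \<in> {0..1}"
        using grid dn i by (auto simp del: of_nat_Suc)
    qed
    show "(\<Sum>i<m. dist (\<phi> (t i)) (\<phi> (t (Suc i)))) \<le> s / c"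
    proof (rule LIMSEQ_le)
      show "(\<lambda>n. \<Sum>i<m. dist (\<phi> (real (d n i) / real (Suc n))) (\<phi> (real (d n (Suc i)) / real (Suc n))))
          \<longlonglongrightarrow> (\<Sum>i<m. dist (\<phi> (t i)) (\<phi> (t (Suc i))))"
        by (intro tendsto_sum tendsto_dist lim) auto
      show "(\<lambda>n. action_sum l (Suc n) \<phi> / c) \<longlonglongrightarrow> s / c" using c(2) by (intro tendsto_divide s) auto
      show "\<exists>N. \<forall>n\<ge>N. (\<Sum>i<m. dist (\<phi> (real (d n i) / real (Suc n))) (\<phi> (real (d n (Suc i)) / real (Suc n))))
          \<le> action_sum l (Suc n) \<phi> / c"
      proof (intro exI[of _ 0] allI impI)
        fix n :: nat
        let ?p = "\<lambda>i. \<phi> (real i / real (Suc n))"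
        have tel: "i \<le> m \<Longrightarrow> d n 0 \<le> d n i \<and> (\<Sum>i<i. \<Sum>j\<in>{d n i..<d n (Suc i)}. dist (?p j) (?p (Suc j)))
          = (\<Sum>j\<in>{d n 0..<d n i}. dist (?p j) (?p (Suc j)))" for i
        proof (induction i)
          case (Suc i)
          then show ?case using dmono[of i n]
            sum.atLeastLessThan_concat[of "d n 0" "d n i" "d n (Suc i)" "\<lambda>j. dist (?p j) (?p (Suc j))"]
            by (auto simp del: of_nat_Suc)
        qed simp
        have "(\<Sum>i<m. dist (?p (d n i)) (?p (d n (Suc i)))) \<le> (\<Sum>i<m. \<Sum>j\<in>{d n i..<d n (Suc i)}. dist (?p j) (?p (Suc j)))"
          by (intro sum_mono dist_le_sum_increments dmono) simp
        also have "\<dots> = (\<Sum>j\<in>{d n 0..<d n m}. dist (?p j) (?p (Suc j)))" using tel[of m] by simp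
        also have "\<dots> \<le> (\<Sum>j<Suc n. dist (?p j) (?p (Suc j)))"
          using dn[of m n] by (intro sum_mono2) auto
        also have "\<dots> \<le> (\<Sum>j<Suc n. l (?p j) (?p (Suc j) - ?p j) / c)"
        proof (rule sum_mono)
          fix j assume "j \<in> {..<Suc n}"
          then have "?p j \<in> K" using grid[of j n] im by (auto simp del: of_nat_Suc)
          then have "c * norm (?p (Suc j) - ?p j) \<le> l (?p j) (?p (Suc j) - ?p j)" by (rule c(1))
          then show "dist (?p j) (?p (Suc j)) \<le> l (?p j) (?p (Suc j) - ?p j) / c"
            using c(2) by (simp add: pos_le_divide_eq dist_norm norm_minus_commute mult.commute del: of_nat_Suc)
        qed
        also have "\<dots> = action_sum l (Suc n) \<phi> / c" by (simp only: action_sum_def sum_divide_distrib)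
        finally show "(\<Sum>i<m. dist (?p (d n i)) (?p (d n (Suc i)))) \<le> action_sum l (Suc n) \<phi> / c" .
      qed
    qed
  qed
  then show ?thesis unfolding param_length_def by (auto intro!: SUP_least)
qed

section \<open>Existence of minimizers\<close>

lemma local_action_comparable_norm:
  fixes l :: "real ^ 'n \<Rightarrow> real ^ 'n \<Rightarrow> real"
  assumes l: "local_action D l" and D: "open D" "x \<in> D" and pos: "\<And>y. y \<noteq> 0 \<Longrightarrow> 0 < l x y"
  obtains \<rho> c C where "0 < \<rho>" "0 < c" "0 < C" "cball x \<rho> \<subseteq> D"
    "\<And>z y. z \<in> cball x \<rho> \<Longrightarrow> c * norm y \<le> l z y" "\<And>z y. z \<in> cball x \<rho> \<Longrightarrow> l z y \<le> C * norm y"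
proof -
  have lc: "continuous_on (D \<times> UNIV) (\<lambda>(x, y). l x y)"
    and lh: "\<And>x y c. x \<in> D \<Longrightarrow> 0 \<le> c \<Longrightarrow> l x (c *\<^sub>R y) = c * l x y"
    using l by (auto simp: local_action_def)
  have cx: "continuous_on (sphere 0 1) (l x)"
  proof -
    have "continuous_on (sphere 0 1) (\<lambda>y. (\<lambda>(x, y). l x y) (x, y))"
      using D by (intro continuous_on_compose2[OF lc] continuous_intros) auto
    then show ?thesis by simp
  qed
  have ne: "sphere (0 :: real ^ 'n) 1 \<noteq> {}" by simp
  obtain p where p: "p \<in> sphere 0 1" "\<And>y. y \<in> sphere 0 1 \<Longrightarrow> l x p \<le> l x y"
    using continuous_attains_inf[OF compact_sphere ne cx] by blast
  obtain q where q: "q \<in> sphere 0 1" "\<And>y. y \<in> sphere 0 1 \<Longrightarrow> l x y \<le> l x q"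
    using continuous_attains_sup[OF compact_sphere ne cx] by blast
  define m where "m = l x p"
  have m: "0 < m" unfolding m_def using p(1) by (intro pos) auto
  have lx: "m * norm y \<le> l x y \<and> l x y \<le> l x q * norm y" for y
  proof (cases "y = 0")
    case True
    then show ?thesis using lh[OF D(2), of 0 0] by simp
  next
    case False
    define v where "v = y /\<^sub>R norm y"
    have v: "v \<in> sphere 0 1" "y = norm y *\<^sub>R v" using False by (auto simp: v_def)
    have "l x y = norm y * l x v" using lh[OF D(2), of "norm y" v] v(2) by simp
    moreover have "norm y * m \<le> norm y * l x v" "norm y * l x v \<le> norm y * l x q"
      unfolding m_def using p(2)[OF v(1)] q(2)[OF v(1)] by (intro mult_left_mono; simp)+
    ultimately show ?thesis by (simp add: mult.commute)
  qed
  obtain \<rho>0 where \<rho>0: "0 < \<rho>0" "cball x \<rho>0 \<subseteq> D" using D open_contains_cball by blast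
  have m2: "0 < m / 2" using m by simp
  obtain \<delta> where \<delta>: "0 < \<delta>"
    "\<And>z z' y. \<lbrakk>z \<in> cball x \<rho>0; z' \<in> cball x \<rho>0; dist z z' < \<delta>\<rbrakk> \<Longrightarrow> \<bar>l z y - l z' y\<bar> \<le> m / 2 * norm y"
    using local_action_modulus[OF l compact_cball \<rho>0(2) m2] by blast
  define \<rho> where "\<rho> = min \<rho>0 (\<delta> / 2)"
  have cl: "\<bar>l z y - l x y\<bar> \<le> m / 2 * norm y" if "z \<in> cball x \<rho>" for z y
    using that \<rho>0(1) \<delta>(1) by (intro \<delta>(2)) (auto simp: \<rho>_def dist_commute)
  show thesis
  proof (rule that[of \<rho> "m / 2" "l x q + m / 2"])
    show "0 < \<rho>" using \<rho>0 \<delta>(1) by (simp add: \<rho>_def)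
    show "0 < l x q + m / 2" using p(2)[OF q(1)] m by (simp add: m_def)
    show "cball x \<rho> \<subseteq> D" using \<rho>0(2) by (auto simp: \<rho>_def)
    fix z y :: "real ^ 'n" assume z: "z \<in> cball x \<rho>"
    have "m / 2 * norm y = m * norm y - m / 2 * norm y" by simp
    then show "m / 2 * norm y \<le> l z y" using cl[OF z, of y] lx[of y] by linarith
    show "l z y \<le> (l x q + m / 2) * norm y"
      unfolding distrib_right using cl[OF z, of y] lx[of y] by linarith
  qed (fact m2)
qed

lemma lipschitz_paths_mono: "\<phi> \<in> lipschitz_paths M A a b \<Longrightarrow> A \<subseteq> B \<Longrightarrow> \<phi> \<in> lipschitz_paths M B a b"
  unfolding lipschitz_paths_def by blast

lemma lipschitz_paths_in_cball:
  assumes \<phi>: "\<phi> \<in> lipschitz_paths M K x b"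
  shows "\<phi> \<in> lipschitz_paths M (cball x M \<inter> K) x b"
proof -
  have lip: "M-lipschitz_on {0..1} \<phi>" and \<phi>0: "\<phi> 0 = x" using \<phi> by (auto simp: lipschitz_paths_def)
  have "\<phi> t \<in> cball x M" if t: "t \<in> {0..1}" for t
  proof -
    have "dist (\<phi> 0) (\<phi> t) \<le> M * dist 0 t" using t by (intro lipschitz_onD[OF lip]) auto
    also have "\<dots> \<le> M * 1" using t lipschitz_on_nonneg[OF lip] by (intro mult_left_mono) auto
    finally show ?thesis using \<phi>0 by simp
  qed
  then show ?thesis using \<phi> by (auto simp: lipschitz_paths_def)
qed

lemma lipschitz_paths_join:
  assumes 1: "\<phi>\<^sub>1 \<in> lipschitz_paths M K x a" and 2: "\<phi>\<^sub>2 \<in> lipschitz_paths M K x b"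
  obtains \<phi> where "\<phi> \<in> lipschitz_paths (2 * M) K a b"
proof -
  have lip: "M-lipschitz_on {0..1} \<phi>\<^sub>1" "M-lipschitz_on {0..1} \<phi>\<^sub>2"
    and im: "\<phi>\<^sub>1 ` {0..1} \<subseteq> K" "\<phi>\<^sub>2 ` {0..1} \<subseteq> K"
    and e: "\<phi>\<^sub>1 0 = x" "\<phi>\<^sub>1 1 = a" "\<phi>\<^sub>2 0 = x" "\<phi>\<^sub>2 1 = b"
    using 1 2 by (auto simp: lipschitz_paths_def)
  have M: "0 \<le> 2 * M" using lipschitz_on_nonneg[OF lip(1)] by simp
  define \<phi> where "\<phi> = (\<lambda>t::real. if t \<le> 1/2 then \<phi>\<^sub>1 (1 - 2 * t) else \<phi>\<^sub>2 (2 * t - 1))"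
  have "(2 * M)-lipschitz_on {0..1} \<phi>"
    unfolding \<phi>_def
  proof (rule lipschitz_on_concat)
    show "(2 * M)-lipschitz_on {0..1/2} (\<lambda>t. \<phi>\<^sub>1 (1 - 2 * t))"
    proof (rule lipschitz_onI[OF _ M])
      fix s t :: real assume "s \<in> {0..1/2}" "t \<in> {0..1/2}"
      then have "dist (\<phi>\<^sub>1 (1 - 2 * s)) (\<phi>\<^sub>1 (1 - 2 * t)) \<le> M * dist (1 - 2 * s) (1 - 2 * t)"
        by (intro lipschitz_onD[OF lip(1)]) auto
      also have "dist (1 - 2 * s) (1 - 2 * t) = 2 * dist s t" by (auto simp: dist_real_def abs_if)
      finally show "dist (\<phi>\<^sub>1 (1 - 2 * s)) (\<phi>\<^sub>1 (1 - 2 * t)) \<le> 2 * M * dist s t" by simp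
    qed
    show "(2 * M)-lipschitz_on {1/2..1} (\<lambda>t. \<phi>\<^sub>2 (2 * t - 1))"
    proof (rule lipschitz_onI[OF _ M])
      fix s t :: real assume "s \<in> {1/2..1}" "t \<in> {1/2..1}"
      then have "dist (\<phi>\<^sub>2 (2 * s - 1)) (\<phi>\<^sub>2 (2 * t - 1)) \<le> M * dist (2 * s - 1) (2 * t - 1)"
        by (intro lipschitz_onD[OF lip(2)]) auto
      also have "dist (2 * s - 1) (2 * t - 1) = 2 * dist s t" by (auto simp: dist_real_def abs_if)
      finally show "dist (\<phi>\<^sub>2 (2 * s - 1)) (\<phi>\<^sub>2 (2 * t - 1)) \<le> 2 * M * dist s t" by simp
    qed
  qed (use e in simp)
  moreover have "\<phi> ` {0..1} \<subseteq> K" using im by (auto simp: \<phi>_def image_subset_iff)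
  moreover have "\<phi> 0 = a" "\<phi> 1 = b" using e by (auto simp: \<phi>_def)
  ultimately show thesis using that by (simp add: lipschitz_paths_def)
qed

text \<open>The Arzela--Ascoli theorem; the uniform Lipschitz constant passes to the limit.\<close>

lemma lipschitz_paths_sequentially_compact:
  assumes K: "compact K" and \<phi>: "\<And>k. \<phi> k \<in> lipschitz_paths M K a b"
  obtains \<theta> q where "\<theta> \<in> lipschitz_paths M K a b" "strict_mono (q :: nat \<Rightarrow> nat)"
    "\<forall>t\<in>{0..1}. (\<lambda>k. \<phi> (q k) t) \<longlonglongrightarrow> \<theta> t"
proof -
  have lip: "M-lipschitz_on {0..1} (\<phi> k)" and im: "\<phi> k ` {0..1} \<subseteq> K"
    and ends: "\<phi> k 0 = a" "\<phi> k 1 = b" for k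
    using \<phi>[of k] by (auto simp: lipschitz_paths_def)
  have M: "0 \<le> M" using lipschitz_on_nonneg[OF lip] .
  obtain B where B: "\<And>z. z \<in> K \<Longrightarrow> norm z \<le> B"
    using compact_imp_bounded[OF K] by (auto simp: bounded_iff)
  obtain \<theta> q where q: "strict_mono (q :: nat \<Rightarrow> nat)"
    and conv: "\<And>e. 0 < e \<Longrightarrow> \<exists>N. \<forall>n x. n \<ge> N \<and> x \<in> {0..1} \<longrightarrow> norm (\<phi> (q n) x - \<theta> x) < e"
  proof (rule Arzela_Ascoli[of "{0..1::real}" \<phi> B])
    show "norm (\<phi> n t) \<le> B" if "t \<in> {0..1}" for n t using B im[of n] that by blast
    fix t e :: real assume t: "t \<in> {0..1}" "0 < e"
    show "\<exists>d>0. \<forall>n y. y \<in> {0..1} \<and> norm (t - y) < d \<longrightarrow> norm (\<phi> n t - \<phi> n y) < e"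
    proof (intro exI[of _ "e / (M + 1)"] conjI allI impI)
      fix n y assume y: "y \<in> {0..1} \<and> norm (t - y) < e / (M + 1)"
      have "norm (\<phi> n t - \<phi> n y) \<le> M * norm (t - y)"
        using lipschitz_onD[OF lip t(1), of y n] y by (simp add: dist_norm)
      also have "\<dots> \<le> M * (e / (M + 1))" using y M by (intro mult_left_mono) auto
      also have "\<dots> < e" using M t(2) by (simp add: field_simps)
      finally show "norm (\<phi> n t - \<phi> n y) < e" .
    qed (use t M in simp)
  qed auto
  have lim: "(\<lambda>k. \<phi> (q k) t) \<longlonglongrightarrow> \<theta> t" if "t \<in> {0..1}" for t
    using conv that unfolding LIMSEQ_iff by blast
  have "M-lipschitz_on {0..1} \<theta>"
  proof (rule lipschitz_onI[OF _ M])
    fix s t :: real assume st: "s \<in> {0..1}" "t \<in> {0..1}"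
    show "dist (\<theta> s) (\<theta> t) \<le> M * dist s t"
      by (rule LIMSEQ_le_const2[OF tendsto_dist[OF lim[OF st(1)] lim[OF st(2)]]])
        (use lipschitz_onD[OF lip st] in blast)
  qed
  moreover have "\<theta> ` {0..1} \<subseteq> K"
    using closed_sequentially[OF compact_imp_closed[OF K] _ lim] im by blast
  moreover have "\<theta> 0 = a" "\<theta> 1 = b"
    using LIMSEQ_unique[OF lim[of 0]] LIMSEQ_unique[OF lim[of 1]] by (auto simp: ends)
  ultimately show thesis using that q lim by (simp add: lipschitz_paths_def)
qed

text \<open>
  A first Lipschitz parameterization \<open>\<theta>\<close>, with a constant that depends on \<open>\<gamma>\<close>, shows that \<open>\<gamma>\<close> stays in
  the ball and that its length is at most its action divided by \<open>c\<close>. This bound allows a second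
  parameterization \<open>\<phi>\<close> whose constant does not depend on \<open>\<gamma>\<close>.
\<close>

lemma low_action_curve_representative:
  fixes S :: "('n::finite) curve \<Rightarrow> ennreal"
  assumes S: "geometric_action D l S" and DtD: "Dt \<subseteq> D"
    and c: "\<And>z y. z \<in> cball x \<rho> \<Longrightarrow> c * norm y \<le> l z y" "0 < c"
    and a: "a \<in> cball x r" and g: "\<gamma> \<in> connecting_curves D Dt a b"
    and low: "S \<gamma> < ennreal (c * (\<rho> - r))" and M: "\<rho> - r < M"
  obtains \<phi> s where "\<phi> \<in> lipschitz_paths M (cball x \<rho> \<inter> Dt) a b" "0 \<le> s" "S \<gamma> = ennreal s"
    "(\<lambda>n. action_sum l (Suc n) \<phi>) \<longlonglongrightarrow> s"
proof -
  have \<gamma>c: "\<gamma> \<in> curves D" and len: "curve_length \<gamma> < \<infinity>"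
    using g by (auto simp: connecting_curves_def rectifiable_curves_def)
  have l0: "\<And>z y. z \<in> D \<Longrightarrow> 0 \<le> l z y"
    using S by (auto simp: geometric_action_def local_action_def)
  have weaken: "\<phi> \<in> lipschitz_paths L D a b" if "\<phi> \<in> lipschitz_paths L Dt a b" for \<phi> L
    using lipschitz_paths_mono[OF that DtD] .
  obtain L where L: "0 \<le> L" "curve_length \<gamma> = ennreal L" using len by (cases "curve_length \<gamma>") auto
  then have "curve_length \<gamma> < ennreal (L + 1)" by (simp add: ennreal_lessI)
  then obtain \<theta> where \<theta>: "(1, \<theta>) \<in> \<gamma>" "\<theta> \<in> lipschitz_paths (L + 1) Dt a b"
    using connecting_curve_lipschitz_representative[OF g] by blast
  obtain s where s: "0 \<le> s" "S \<gamma> = ennreal s" "(\<lambda>n. action_sum l (Suc n) \<theta>) \<longlonglongrightarrow> s"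
    using geometric_action_eq_lim[OF S \<gamma>c \<theta>(1) weaken[OF \<theta>(2)]] by blast
  have sl: "s < c * (\<rho> - r)" using low s by (simp add: ennreal_less_iff)
  have cont: "continuous_on {0..1} \<theta>" and im: "\<theta> ` {0..1} \<subseteq> Dt" and \<theta>0: "\<theta> 0 = a"
    using \<theta>(2) lipschitz_on_continuous_on by (auto simp: lipschitz_paths_def)
  have "\<theta> t \<in> cball x \<rho>" if t: "t \<in> {0..1}" for t
  proof (rule ccontr)
    assume "\<theta> t \<notin> cball x \<rho>"
    then have "c * (\<rho> - r) \<le> s"
      by (intro action_limit_escape[OF cont _ l0 c(1) _ _ t _ s(3)]) (use im DtD c a \<theta>0 in auto)
    then show False using sl by simp
  qed
  then have imK: "\<theta> ` {0..1} \<subseteq> cball x \<rho> \<inter> Dt" using im by blast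
  then have "param_length (1, \<theta>) \<le> ennreal (s / c)"
    using c s(3) by (intro param_length_le_action_limit[OF cont imK]) auto
  moreover have "s / c < M"
  proof -
    have "c * (\<rho> - r) < c * M" using M c(2) by (rule mult_strict_left_mono)
    with sl have "s < c * M" by (rule less_trans)
    then show ?thesis using c(2) by (simp add: pos_divide_less_eq mult.commute)
  qed
  moreover have "0 < M"
    by (rule le_less_trans[OF divide_nonneg_pos[OF s(1) c(2)] \<open>s / c < M\<close>])
  ultimately have "curve_length \<gamma> < ennreal M"
    unfolding curve_length_eq[OF \<gamma>c \<theta>(1)] using s(1) c(2)
    by (meson ennreal_lessI le_less_trans)
  then obtain \<phi> where \<phi>: "(1, \<phi>) \<in> \<gamma>" "\<phi> \<in> lipschitz_paths M Dt a b"
    using connecting_curve_lipschitz_representative[OF g] by blast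
  have "\<phi> ` {0..1} \<subseteq> cball x \<rho> \<inter> Dt"
    using imK curve_image_eq[OF \<gamma>c \<theta>(1)] curve_image_eq[OF \<gamma>c \<phi>(1)] by simp
  then have "\<phi> \<in> lipschitz_paths M (cball x \<rho> \<inter> Dt) a b" using \<phi>(2) by (simp add: lipschitz_paths_def)
  with geometric_action_eq_lim[OF S \<gamma>c \<phi>(1) weaken[OF \<phi>(2)]] show thesis
    using that by metis
qed

theorem proposition2:
  fixes D Dt :: "(real ^ 'n) set"
    and l :: "real ^ 'n \<Rightarrow> real ^ 'n \<Rightarrow> real"
    and S :: "'n curve \<Rightarrow> ennreal"
    and x :: "real ^ 'n"
  assumes "open D" and "connected D"
    and "connected Dt" and "closedin (top_of_set D) Dt"
    and "\<forall>z\<in>Dt. \<forall>\<nu>>0. \<exists>r>0. \<forall>w \<in> cball z r \<inter> Dt.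
           \<exists>\<gamma> \<in> connecting_curves D Dt z w. curve_length \<gamma> \<le> ennreal \<nu>"
    and "geometric_action D l S"
    and "x \<in> Dt"
    and "\<forall>y. y \<noteq> 0 \<longrightarrow> l x y > 0"
  shows "has_strong_local_minimizers D Dt S x"
proof -
  note S = \<open>geometric_action D l S\<close>
  have l: "local_action D l" using S by (simp add: geometric_action_def)
  have DtD: "Dt \<subseteq> D" using closedin_subset[OF assms(4)] by simp
  obtain \<rho> c C where \<rho>: "0 < \<rho>" "cball x \<rho> \<subseteq> D" and c: "0 < c" "0 < C"
    and lb: "\<And>z y. z \<in> cball x \<rho> \<Longrightarrow> c * norm y \<le> l z y"
    and ub: "\<And>z y. z \<in> cball x \<rho> \<Longrightarrow> l z y \<le> C * norm y"
  proof -
    have "x \<in> D" using \<open>x \<in> Dt\<close> DtD by blast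
    moreover have "0 < l x y" if "y \<noteq> 0" for y using assms(8) that by blast
    ultimately show thesis
      using local_action_comparable_norm[OF l \<open>open D\<close>] that by metis
  qed
  define K where "K = cball x \<rho> \<inter> Dt"
  have K: "compact K"
  proof -
    obtain F where F: "closed F" "Dt = D \<inter> F" using assms(4) closedin_closed by metis
    then have "K = cball x \<rho> \<inter> F" using \<rho> by (auto simp: K_def)
    then show ?thesis using F by (simp add: compact_Int_closed)
  qed
  have KD: "K \<subseteq> D" "K \<subseteq> Dt" using DtD by (auto simp: K_def)
  \<comment> \<open>curves of length below \<open>2 * \<nu>\<close> from \<open>x\<close> stay in the ball, and two of them joined have action
      below \<open>c * \<rho> / 2\<close>\<close>
  define \<nu> where "\<nu> = min (\<rho> / 2) (c * \<rho> / (16 * C))"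
  have \<nu>: "0 < \<nu>" "2 * \<nu> \<le> \<rho>" "C * (2 * (2 * \<nu>)) < c * (\<rho> / 2)"
  proof -
    show "0 < \<nu>" "2 * \<nu> \<le> \<rho>" using \<rho> c by (auto simp: \<nu>_def)
    have "C * \<nu> \<le> C * (c * \<rho> / (16 * C))" using c by (intro mult_left_mono) (auto simp: \<nu>_def)
    also have "\<dots> = c * \<rho> / 16" using c by simp
    finally show "C * (2 * (2 * \<nu>)) < c * (\<rho> / 2)" using mult_pos_pos[OF c(1) \<rho>(1)] by simp
  qed
  obtain r0 where r0: "0 < r0" "\<And>w. w \<in> cball x r0 \<inter> Dt \<Longrightarrow>
      \<exists>\<gamma> \<in> connecting_curves D Dt x w. curve_length \<gamma> \<le> ennreal \<nu>"
    using assms(5) \<open>x \<in> Dt\<close> \<nu>(1) by metis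
  define r where "r = min r0 (\<rho> / 2)"
  have r: "0 < r" "r \<le> \<rho> / 2" using r0(1) \<rho>(1) by (auto simp: r_def)
  define M where "M = \<rho> + 1"
  have M: "0 < M" "\<rho> - r < M" using \<rho>(1) r by (auto simp: M_def)
  have main: "\<exists>\<gamma>. strong_minimizer D Dt S a b \<gamma> \<and> curve_image \<gamma> \<subseteq> K \<and> curve_length \<gamma> \<le> ennreal M"
    if a: "a \<in> cball x r \<inter> Dt" and b: "b \<in> cball x r \<inter> Dt" for a b
  proof -
    have ar: "a \<in> cball x r" using a by blast
    let ?G = "connecting_curves D Dt a b"
    have path: "\<exists>\<phi>. \<phi> \<in> lipschitz_paths (2 * \<nu>) K x w" if "w \<in> cball x r \<inter> Dt" for w
    proof -
      have "w \<in> cball x r0 \<inter> Dt" using that by (auto simp: r_def)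
      from r0(2)[OF this] obtain \<gamma> where \<gamma>: "\<gamma> \<in> connecting_curves D Dt x w" "curve_length \<gamma> \<le> ennreal \<nu>"
        by blast
      moreover have "ennreal \<nu> < ennreal (2 * \<nu>)" using \<nu>(1) by (intro ennreal_lessI) auto
      ultimately obtain \<phi> where \<phi>: "\<phi> \<in> lipschitz_paths (2 * \<nu>) Dt x w"
        using connecting_curve_lipschitz_representative[OF \<gamma>(1)] le_less_trans by metis
      have "cball x (2 * \<nu>) \<inter> Dt \<subseteq> K" using \<nu>(2) by (auto simp: K_def)
      then show ?thesis using lipschitz_paths_mono[OF lipschitz_paths_in_cball[OF \<phi>]] by blast
    qed
    obtain \<phi>a \<phi>b where "\<phi>a \<in> lipschitz_paths (2 * \<nu>) K x a" "\<phi>b \<in> lipschitz_paths (2 * \<nu>) K x b"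
      using path[OF a] path[OF b] by blast
    then obtain \<phi>0 where \<phi>0: "\<phi>0 \<in> lipschitz_paths (2 * (2 * \<nu>)) K a b"
      by (rule lipschitz_paths_join)
    have \<phi>0D: "\<phi>0 \<in> lipschitz_paths (2 * (2 * \<nu>)) Dt a b" "\<phi>0 \<in> lipschitz_paths (2 * (2 * \<nu>)) D a b"
      using lipschitz_paths_mono[OF \<phi>0] KD by blast+
    obtain \<gamma>0 where \<gamma>0: "\<gamma>0 \<in> ?G" "(1, \<phi>0) \<in> \<gamma>0"
      by (rule lipschitz_path_curve[OF \<phi>0D(1) DtD])
    have G: "\<gamma> \<in> curves D" if "\<gamma> \<in> ?G" for \<gamma>
      using that by (simp add: connecting_curves_def rectifiable_curves_def)
    obtain s0 where s0: "0 \<le> s0" "S \<gamma>0 = ennreal s0" "(\<lambda>n. action_sum l (Suc n) \<phi>0) \<longlonglongrightarrow> s0"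
      by (rule geometric_action_eq_lim[OF S G[OF \<gamma>0(1)] \<gamma>0(2) \<phi>0D(2)])
    have "s0 \<le> C * (2 * (2 * \<nu>))"
      using \<phi>0 c ub by (intro action_limit_upper_bound[OF _ _ _ _ s0(3), where K = K])
        (auto simp: lipschitz_paths_def K_def)
    also have "\<dots> < c * (\<rho> / 2)" by (fact \<nu>(3))
    also have "\<dots> \<le> c * (\<rho> - r)" using c r by (intro mult_left_mono) auto
    finally have S\<gamma>0: "S \<gamma>0 < ennreal (c * (\<rho> - r))"
      unfolding s0(2) using c r \<rho> by (intro ennreal_lessI) auto
    define I where "I = (INF \<gamma>\<in>?G. S \<gamma>)"
    have I: "I < ennreal (c * (\<rho> - r))" unfolding I_def using INF_lower[OF \<gamma>0(1)] S\<gamma>0 by (rule le_less_trans)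
    then obtain i where i: "0 \<le> i" "I = ennreal i" by (cases I) auto
    \<comment> \<open>a minimizing sequence\<close>
    have "\<exists>\<phi> s. \<phi> \<in> lipschitz_paths M K a b \<and> (\<lambda>n. action_sum l (Suc n) \<phi>) \<longlonglongrightarrow> s \<and>
        i \<le> s \<and> s \<le> i + 1 / real (Suc k)" for k
    proof -
      have "I < ennreal (i + 1 / real (Suc k))" unfolding i(2) using i(1)
        by (intro ennreal_lessI add_nonneg_pos) auto
      then have "(INF \<gamma>\<in>?G. S \<gamma>) < min (ennreal (i + 1 / real (Suc k))) (ennreal (c * (\<rho> - r)))"
        using I unfolding I_def by (rule min_less_iff_conj[THEN iffD2, OF conjI])
      then obtain \<gamma> where "\<gamma> \<in> ?G" "S \<gamma> < min (ennreal (i + 1 / real (Suc k))) (ennreal (c * (\<rho> - r)))"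
        unfolding INF_less_iff by (elim bexE)
      then have \<gamma>: "\<gamma> \<in> ?G" "S \<gamma> < ennreal (i + 1 / real (Suc k))" "S \<gamma> < ennreal (c * (\<rho> - r))"
        by (simp_all only: min_less_iff_conj)
      obtain \<phi> s where \<phi>: "\<phi> \<in> lipschitz_paths M K a b" "0 \<le> s" "S \<gamma> = ennreal s"
        "(\<lambda>n. action_sum l (Suc n) \<phi>) \<longlonglongrightarrow> s"
        unfolding K_def by (rule low_action_curve_representative[OF S DtD lb c(1) ar \<gamma>(1,3) M(2)])
      have "I \<le> S \<gamma>" unfolding I_def using \<gamma>(1) by (rule INF_lower)
      then have "i \<le> s" using \<phi>(2,3) i by simp
      moreover have "s \<le> i + 1 / real (Suc k)" using \<gamma>(2) \<phi>(2,3) by (simp add: ennreal_less_iff)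
      ultimately show ?thesis using \<phi> by blast
    qed
    then obtain \<Phi> s where \<Phi>: "\<And>k. \<Phi> k \<in> lipschitz_paths M K a b"
      "\<And>k. (\<lambda>n. action_sum l (Suc n) (\<Phi> k)) \<longlonglongrightarrow> s k"
      and s: "\<And>k. i \<le> s k" "\<And>k. s k \<le> i + 1 / real (Suc k)" by metis
    have s_lim: "s \<longlonglongrightarrow> i"
    proof (rule tendsto_sandwich[of "\<lambda>_. i" _ _ "\<lambda>k. i + 1 / real (Suc k)"])
      have "(\<lambda>k. i + 1 / real (Suc k)) \<longlonglongrightarrow> i + 0" by (intro tendsto_intros LIMSEQ_Suc[OF lim_1_over_n])
      then show "(\<lambda>k. i + 1 / real (Suc k)) \<longlonglongrightarrow> i" by simp
    qed (use s in \<open>simp_all del: of_nat_Suc\<close>)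
    obtain \<phi> q where \<phi>: "\<phi> \<in> lipschitz_paths M K a b" and q: "strict_mono (q :: nat \<Rightarrow> nat)"
      and conv: "\<forall>t\<in>{0..1}. (\<lambda>k. \<Phi> (q k) t) \<longlonglongrightarrow> \<phi> t"
      by (rule lipschitz_paths_sequentially_compact[where \<phi> = \<Phi>, OF K \<Phi>(1)])
    have \<phi>D: "\<phi> \<in> lipschitz_paths M Dt a b" "\<phi> \<in> lipschitz_paths M D a b"
      using lipschitz_paths_mono[OF \<phi>] KD by blast+
    obtain \<gamma> where \<gamma>: "\<gamma> \<in> ?G" "(1, \<phi>) \<in> \<gamma>" "curve_image \<gamma> = \<phi> ` {0..1}" "curve_length \<gamma> \<le> ennreal M"
      by (rule lipschitz_path_curve[OF \<phi>D(1) DtD])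
    obtain s' where s': "0 \<le> s'" "S \<gamma> = ennreal s'" "(\<lambda>n. action_sum l (Suc n) \<phi>) \<longlonglongrightarrow> s'"
      by (rule geometric_action_eq_lim[OF S G[OF \<gamma>(1)] \<gamma>(2) \<phi>D(2)])
    have sq: "(\<lambda>k. s (q k)) \<longlonglongrightarrow> i" using LIMSEQ_subseq_LIMSEQ[OF s_lim q] by (simp add: o_def)
    have "s' \<le> i"
      by (rule action_limit_lower_semicontinuous[where \<phi>k = "\<lambda>k. \<Phi> (q k)" and s = "\<lambda>k. s (q k)",
            OF l K KD(1) \<Phi>(1) \<phi> bspec[OF conv] \<Phi>(2) s'(3) sq])
    then have "S \<gamma> \<le> I" using s'(2) i by (simp add: ennreal_leI)
    moreover have "I \<le> S \<gamma>" unfolding I_def using \<gamma>(1) by (rule INF_lower)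
    ultimately have "strong_minimizer D Dt S a b \<gamma>"
      using \<gamma>(1) by (simp add: strong_minimizer_def I_def)
    moreover have "curve_image \<gamma> \<subseteq> K" using \<gamma>(3) \<phi> by (simp add: lipschitz_paths_def)
    ultimately show ?thesis using \<gamma>(4) by blast
  qed
  show ?thesis
    unfolding has_strong_local_minimizers_def
  proof (rule exI[of _ r], intro conjI r(1), rule exI[of _ M], intro conjI M(1),
      rule exI[of _ K], intro conjI K KD(2) ballI)
    fix a b assume "a \<in> cball x r \<inter> Dt" "b \<in> cball x r \<inter> Dt"
    then show "\<exists>\<gamma>. strong_minimizer D Dt S a b \<gamma> \<and> curve_image \<gamma> \<subseteq> K \<and> curve_length \<gamma> \<le> ennreal M"
      by (rule main)
  qed
qed

end
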